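(* Let $\beta>2$, $\kappa>0$, $\lambda_{\mathrm B}>0$, $\lambda_{\mathrm D}>0$, and consider the network model described in the context, with all devices active. Then for every $\tau_{\mathrm B}\ge1$ the probability $$\mathcal P_{\mathrm B}(\tau_{\mathrm B})=\mathbf P\left(\max_i\frac{F_i/\ell(X_i)}{I_{\mathrm D}+[I_{\mathrm B}-F_i/\ell(X_i)]}>\tau_{\mathrm B}\right)$$ that a device at the origin connects to a base station, given interference from the other base stations and from the devices, equals $$\mathcal P_{\mathrm B}(\tau_{\mathrm B})=\frac{\tau_{\mathrm B}^{-2/\beta}}{\Gamma(1+2/\beta)\,\Gamma(1-2/\beta)}\cdot\frac{a_{\mathrm B}}{a_{\mathrm B}+a_{\mathrm D}}.$$
   Context: Network model. $\Phi=\{X_i\}_{i\ge1}$ (base stations) and $\Psi=\{Y_j\}_{j\ge1}$ (devices) are independent homogeneous Poisson point processes on $\mathbb R^2$ with densities $\lambda_{\mathrm B}$ and $\lambda_{\mathrm D}$. The path-loss function is $\ell(x)=(\kappa|x|)^{\beta}$ for $x\in\mathbb R^2$. The marks $F_i$ of base stations are i.i.d. copies of a positive random variable $F$ with $0<\mathbf E(F^{2/\beta})<\infty$; the marks $E_j$ of devices are i.i.d. exponential random variables with mean $1$. All marks and point processes are independent. Transmission powers are normalized to $1$. Total interferences at the origin: $I_{\mathrm B}=\sum_{i}F_i/\ell(X_i)$ and $I_{\mathrm D}=\sum_{j}E_j/\ell(Y_j)$. Propagation constants (with $\Gamma$ the gamma function): $$a_{\mathrm B}=\frac{\lambda_{\mathrm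 B}\pi\,\mathbf E(F^{2/\beta})}{\kappa^2},\qquad a_{\mathrm D}=\frac{\lambda_{\mathrm D}\pi\,\Gamma(1+2/\beta)}{\kappa^2}.$$ *)

theory Defs
  imports "HOL-Probability.Probability"
begin

text \<open>
  A point process is given by an enumeration \<open>X 0, X 1, \<dots>\<close> of its points (random vectors);
  points are counted by index, that is, with multiplicity.
\<close>

definition num_points :: "(nat \<Rightarrow> 'a \<Rightarrow> real ^ 2) \<Rightarrow> (real ^ 2) set \<Rightarrow> 'a \<Rightarrow> nat" where
  "num_points X B \<omega> = card {i. X i \<omega> \<in> B}"

text \<open>
  The Poisson weights are written out because \<open>poisson_pmf\<close> is unspecified at rate \<open>0\<close>,
  which occurs for Lebesgue null sets \<open>B\<close>. Local finiteness makes the use of \<open>card\<close> harmless.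
\<close>

definition homogeneous_PPP :: "'a measure \<Rightarrow> real \<Rightarrow> (nat \<Rightarrow> 'a \<Rightarrow> real ^ 2) \<Rightarrow> bool" where
  "homogeneous_PPP M lam X \<longleftrightarrow>
     (\<forall>i. X i \<in> borel_measurable M) \<and>
     (AE \<omega> in M. \<forall>B. bounded B \<longrightarrow> finite {i. X i \<omega> \<in> B}) \<and>
     (\<forall>B \<in> sets borel. bounded B \<longrightarrow>
        (\<forall>k. measure M {\<omega> \<in> space M. num_points X B \<omega> = k} =
             (lam * measure lborel B) ^ k / fact k * exp (- (lam * measure lborel B)))) \<and>
     (\<forall>n (B :: nat \<Rightarrow> (real ^ 2) set).
        (\<forall>k<n. B k \<in> sets borel \<and> bounded (B k)) \<longrightarrow> disjoint_family_on B {..<n} \<longrightarrow>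
        prob_space.indep_vars M (\<lambda>_. count_space UNIV) (\<lambda>k. num_points X (B k)) {..<n})"

datatype source = BS_Points | Dev_Points | BS_Mark nat | Dev_Mark nat

text \<open>
  The events determined by each of the random elements that are required to be jointly
  independent: the two point processes (each as one random sequence) and every single mark.
\<close>

fun source_events ::
  "'a measure \<Rightarrow> (nat \<Rightarrow> 'a \<Rightarrow> real ^ 2) \<Rightarrow> (nat \<Rightarrow> 'a \<Rightarrow> real ^ 2) \<Rightarrow>
   (nat \<Rightarrow> 'a \<Rightarrow> real) \<Rightarrow> (nat \<Rightarrow> 'a \<Rightarrow> real) \<Rightarrow> source \<Rightarrow> 'a set set" where
  "source_events M X Y Fm Em BS_Points =
     sets (vimage_algebra (space M) (\<lambda>\<omega> i. X i \<omega>) (Pi\<^sub>M UNIV (\<lambda>_. borel)))"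
| "source_events M X Y Fm Em Dev_Points =
     sets (vimage_algebra (space M) (\<lambda>\<omega> j. Y j \<omega>) (Pi\<^sub>M UNIV (\<lambda>_. borel)))"
| "source_events M X Y Fm Em (BS_Mark i) = sets (vimage_algebra (space M) (Fm i) borel)"
| "source_events M X Y Fm Em (Dev_Mark j) = sets (vimage_algebra (space M) (Em j) borel)"

text \<open>
  \<open>F\<close> is the generic base station mark, \<open>Fm i\<close> the mark of the base station at \<open>X i\<close>, and
  \<open>Em j\<close> the mark of the device at \<open>Y j\<close>.
\<close>

locale network_model = prob_space M
  for M :: "'a measure" +
  fixes beta lamB lamD :: real
    and X Y :: "nat \<Rightarrow> 'a \<Rightarrow> real ^ 2"
    and F :: "'a \<Rightarrow> real"
    and Fm Em :: "nat \<Rightarrow> 'a \<Rightarrow> real"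
  assumes base_stations: "homogeneous_PPP M lamB X"
    and devices: "homogeneous_PPP M lamD Y"
    and F_measurable: "F \<in> borel_measurable M"
    and F_positive: "AE \<omega> in M. 0 < F \<omega>"
    and F_moment_finite: "integrable M (\<lambda>\<omega>. F \<omega> powr (2 / beta))"
    and F_moment_positive: "0 < expectation (\<lambda>\<omega>. F \<omega> powr (2 / beta))"
    and Fm_measurable: "\<And>i. Fm i \<in> borel_measurable M"
    and Fm_distr: "\<And>i. distr M borel (Fm i) = distr M borel F"
    and Em_distr: "\<And>j. distributed M lborel (Em j) (exponential_density 1)"
    and independent: "indep_sets (source_events M X Y Fm Em) UNIV"

definition path_loss :: "real \<Rightarrow> real \<Rightarrow> real ^ 2 \<Rightarrow> real" where
  "path_loss kappa beta x = (kappa * norm x) powr beta"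

text \<open>
  Powers and interferences take values in \<open>[0, \<infinity>]\<close>, so that the infinite sums and suprema are
  defined everywhere. Only on null events can a power or a total interference be infinite, or
  the truncation of negative marks by \<open>ennreal\<close> play a role.
\<close>

definition received_power ::
  "real \<Rightarrow> real \<Rightarrow> (nat \<Rightarrow> 'a \<Rightarrow> real ^ 2) \<Rightarrow> (nat \<Rightarrow> 'a \<Rightarrow> real) \<Rightarrow> nat \<Rightarrow> 'a \<Rightarrow> ennreal" where
  "received_power kappa beta Z G i \<omega> =
     ennreal (G i \<omega>) / ennreal (path_loss kappa beta (Z i \<omega>))"

definition interference ::
  "real \<Rightarrow> real \<Rightarrow> (nat \<Rightarrow> 'a \<Rightarrow> real ^ 2) \<Rightarrow> (nat \<Rightarrow> 'a \<Rightarrow> real) \<Rightarrow> 'a \<Rightarrow> ennreal" where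
  "interference kappa beta Z G \<omega> = (\<Sum>i. received_power kappa beta Z G i \<omega>)"

definition sir ::
  "real \<Rightarrow> real \<Rightarrow> (nat \<Rightarrow> 'a \<Rightarrow> real ^ 2) \<Rightarrow> (nat \<Rightarrow> 'a \<Rightarrow> real ^ 2) \<Rightarrow>
   (nat \<Rightarrow> 'a \<Rightarrow> real) \<Rightarrow> (nat \<Rightarrow> 'a \<Rightarrow> real) \<Rightarrow> nat \<Rightarrow> 'a \<Rightarrow> ennreal" where
  "sir kappa beta X Y Fm Em i \<omega> =
     received_power kappa beta X Fm i \<omega> /
     (interference kappa beta Y Em \<omega> +
      (interference kappa beta X Fm \<omega> - received_power kappa beta X Fm i \<omega>))"

text \<open>
  The maximum over the infinitely many base stations is a supremum; it is almost surely attained,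
  since the received powers tend to \<open>0\<close>.
\<close>

definition connection_probability_BS ::
  "'a measure \<Rightarrow> real \<Rightarrow> real \<Rightarrow> (nat \<Rightarrow> 'a \<Rightarrow> real ^ 2) \<Rightarrow> (nat \<Rightarrow> 'a \<Rightarrow> real ^ 2) \<Rightarrow>
   (nat \<Rightarrow> 'a \<Rightarrow> real) \<Rightarrow> (nat \<Rightarrow> 'a \<Rightarrow> real) \<Rightarrow> real \<Rightarrow> real" where
  "connection_probability_BS M kappa beta X Y Fm Em tau =
     measure M {\<omega> \<in> space M. (SUP i. sir kappa beta X Y Fm Em i \<omega>) > ennreal tau}"

definition propagation_const_BS ::
  "'a measure \<Rightarrow> real \<Rightarrow> real \<Rightarrow> real \<Rightarrow> ('a \<Rightarrow> real) \<Rightarrow> real" where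
  "propagation_const_BS M kappa beta lamB F =
     lamB * pi * (\<integral>\<omega>. F \<omega> powr (2 / beta) \<partial>M) / kappa\<^sup>2"

definition propagation_const_Dev :: "real \<Rightarrow> real \<Rightarrow> real \<Rightarrow> real" where
  "propagation_const_Dev kappa beta lamD = lamD * pi * Gamma (1 + 2 / beta) / kappa\<^sup>2"

end

theory Submission
  imports Defs "HOL-Real_Asymp.Real_Asymp"
begin

text \<open>
  The received powers of the base stations form a Poisson process on \<open>[0, \<infinity>]\<close> whose intensity has
  tail \<open>a\<^sub>B q powr -\<alpha>\<close>, where \<open>\<alpha> = 2 / beta\<close>; those of the devices have tail \<open>a\<^sub>D q powr -\<alpha>\<close>. Hence the
  total interference \<open>I\<close> is stable: \<open>E exp (-s I) = exp (-c s powr \<alpha>)\<close> with \<open>c = (a\<^sub>B + a\<^sub>D) \<Gamma>(1 - \<alpha>)\<close>.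
  Since \<open>tau \<ge> 1\<close>, at most one base station can have a ratio above \<open>tau\<close>, so the connection probability
  is the expected number of base stations that do. By the Mecke formula this number is
  \<open>E (a\<^sub>B (tau I) powr -\<alpha>)\<close>, and \<open>E (I powr -\<alpha>) = \<integral> s powr (\<alpha> - 1) exp (-c s powr \<alpha>) ds / \<Gamma>(\<alpha>)
  = 1 / (c \<Gamma>(1 + \<alpha>))\<close>.

  Everything is derived from Laplace functionals, which for a marked Poisson process follow from the
  counting definition. Differentiating the functional gives, for each power range \<open>A\<close> of finite
  intensity, all moments of \<open>exp (-J)\<close>, where \<open>J\<close> is the interference seen by a base station received
  in \<open>A\<close>; as these variables lie in \<open>[0, 1]\<close>, the moments determine the law, which is the Mecke formula.
\<close>

section \<open>The exponential on the extended half-line\<close>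

text \<open>Powers and interferences live in [0, \<infinity>], and \<open>eneg\<close> extends the
  decaying exponential by 0 at \<open>top\<close>. It is multiplicative on sums, continuous and
  bounded by 1 everywhere, so Laplace functionals make sense before any sum over the points is known
  to converge.

  The model fixes the laws of the counts in bounded sets, not the law of the enumerating sequence: a
  single index has no usable distribution. Statements about individual points therefore pass through
  sums over all indices, and marks are averaged out given the whole sequence of points.

  Two obstacles shape the Mecke formula. The interference faced by a base station is the total minus
  its own power, which can be undone only if that power is finite; and the moment argument needs
  finite measures, whereas the intensity is infinite near power 0. Powers are therefore kept in a
  range bounded away from 0 and excluding \<open>top\<close>, and both restrictions are lifted at
  the end.

  The hypothesis \<open>beta > 2\<close> enters as \<alpha> < 1, which makes the integral of 1 - exp
  (-s p) over the intensity converge near p = 0.\<close>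

definition eneg :: "ennreal \<Rightarrow> ennreal" where
  "eneg x = (if x = top then 0 else ennreal (exp (- enn2real x)))"

lemma eneg_0 [simp]: "eneg 0 = 1"
  by (simp add: eneg_def)

lemma eneg_top [simp]: "eneg top = 0"
  by (simp add: eneg_def)

lemma eneg_ennreal: "0 \<le> r \<Longrightarrow> eneg (ennreal r) = ennreal (exp (- r))"
  by (simp add: eneg_def)

lemma eneg_add: "eneg (x + y) = eneg x * eneg y"
proof (cases x; cases y)
  fix r q :: real assume "x = ennreal r" "y = ennreal q" "0 \<le> r" "0 \<le> q"
  moreover have "exp (- (r + q)) = exp (- r) * exp (- q)"
    by (simp add: exp_add[symmetric])
  ultimately show ?thesis
    by (simp add: eneg_ennreal ennreal_mult'[symmetric] ennreal_plus[symmetric] del: ennreal_plus)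
qed auto

lemma eneg_le_1: "eneg x \<le> 1"
  by (cases x) (auto simp: eneg_ennreal)

lemma eneg_less_top [simp]: "eneg x < top"
  using eneg_le_1[of x] by (simp add: order_le_less_trans)

lemma eneg_neq_top [simp]: "eneg x \<noteq> top"
  using eneg_less_top[of x] unfolding less_top .

lemma eneg_antimono: "x \<le> y \<Longrightarrow> eneg y \<le> eneg x"
  by (cases x; cases y) (auto simp: eneg_ennreal top_unique)

lemma eneg_inj: "eneg x = eneg y \<Longrightarrow> x = y"
  by (cases x; cases y) (auto simp: eneg_ennreal)

lemma measurable_eneg [measurable]: "eneg \<in> borel_measurable borel"
  unfolding eneg_def by measurable

lemma eneg_sum: "finite I \<Longrightarrow> eneg (\<Sum>i\<in>I. f i) = (\<Prod>i\<in>I. eneg (f i))"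
  by (induction I rule: finite_induct) (auto simp: eneg_add)

lemma eneg_of_nat_mult: "eneg (of_nat n * x) = eneg x ^ n"
  by (induction n) (auto simp: eneg_add algebra_simps)

text \<open>The case \<open>l = top\<close> is the one that matters: it allows limits of partial
  sums to be taken before anything is known about their finiteness.\<close>

lemma tendsto_eneg:
  assumes "(f \<longlongrightarrow> l) G"
  shows "((\<lambda>x. eneg (f x)) \<longlongrightarrow> eneg l) G"
proof (cases l)
  case (real r)
  have ev: "eventually (\<lambda>x. f x < top) G"
    using assms by (rule order_tendstoD) (simp add: real)
  have "((\<lambda>x. ennreal (exp (- enn2real (f x)))) \<longlongrightarrow> ennreal (exp (- enn2real l))) G"
    using real assms by (intro tendsto_intros) (auto intro!: tendsto_enn2real)
  moreover have "eventually (\<lambda>x. ennreal (exp (- enn2real (f x))) = eneg (f x)) G"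
    using ev by eventually_elim (auto simp: eneg_def)
  ultimately show ?thesis
    using real by (auto simp: eneg_def intro: Lim_transform_eventually)
next
  case top
  have "((\<lambda>x. eneg (f x)) \<longlongrightarrow> 0) G"
  proof (rule order_tendstoI)
    fix a :: ennreal assume a: "0 < a"
    from a have "0 < min a 1" by auto
    then obtain b where b: "0 < b" "b < a" "b < 1"
      using dense[of 0 "min a 1"] by auto
    obtain r where r: "0 < r" "ennreal r < a" "r < 1"
      using b by (cases b) auto
    have "eventually (\<lambda>x. ennreal (- ln r) < f x) G"
      using assms by (rule order_tendstoD) (simp add: top)
    then show "eventually (\<lambda>x. eneg (f x) < a) G"
    proof eventually_elim
      case (elim x)
      then have "eneg (f x) \<le> eneg (ennreal (- ln r))"
        by (intro eneg_antimono) auto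
      also have "\<dots> = ennreal r"
        using r by (subst eneg_ennreal) auto
      finally show ?case using r by simp
    qed
  qed auto
  then show ?thesis by (simp add: top)
qed

text \<open>Negative logarithm, inverse to \<open>eneg\<close> between [0, \<infinity>] and [0, 1];
  only arguments up to 1 carry meaning. It turns an average of exponentials back into an exponent,
  to which the functional of an unmarked process applies, and it recovers an interference from its
  exponential.\<close>

definition eneg_inv :: "ennreal \<Rightarrow> ennreal" where
  "eneg_inv g = (if g = 0 then top else ennreal (- ln (enn2real g)))"

lemma measurable_eneg_inv [measurable]: "eneg_inv \<in> borel_measurable borel"
  unfolding eneg_inv_def by measurable

lemma eneg_eneg_inv: "g \<le> 1 \<Longrightarrow> eneg (eneg_inv g) = g"
proof (cases g)
  case (real r)
  assume "g \<le> 1"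
  with real show ?thesis
    by (cases "r = 0") (auto simp: eneg_inv_def eneg_ennreal)
qed (auto simp: top_unique)

lemma eneg_inv_eneg: "eneg_inv (eneg x) = x"
  by (rule eneg_inj) (rule eneg_eneg_inv[OF eneg_le_1])

section \<open>Laplace functional of a Poisson process\<close>

text \<open>Dominated convergence with the constant 1 as bound. Since \<open>eneg\<close> is
  continuous at \<open>top\<close>, the limit \<open>T\<close> may be infinite.\<close>

lemma (in prob_space) nn_integral_eneg_tendsto:
  assumes "\<And>n. S n \<in> borel_measurable M" "T \<in> borel_measurable M"
    and "\<And>\<omega>. (\<lambda>n. S n \<omega>) \<longlonglongrightarrow> T \<omega>"
  shows "(\<lambda>n. \<integral>\<^sup>+\<omega>. eneg (S n \<omega>) \<partial>M) \<longlonglongrightarrow> (\<integral>\<^sup>+\<omega>. eneg (T \<omega>) \<partial>M)"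
  using assms
  by (intro nn_integral_dominated_convergence[where w = "\<lambda>_. 1"])
     (auto simp: eneg_le_1 emeasure_space_1 intro!: tendsto_eneg)

lemma (in prob_space) nn_integral_nat_valued:
  assumes [measurable]: "N \<in> measurable M (count_space (UNIV :: nat set))"
  shows "(\<integral>\<^sup>+\<omega>. f (N \<omega>) \<partial>M) = (\<Sum>k. f k * emeasure M {\<omega> \<in> space M. N \<omega> = k})"
proof -
  have "(\<integral>\<^sup>+\<omega>. f (N \<omega>) \<partial>M) = (\<integral>\<^sup>+\<omega>. (\<Sum>k. f k * indicator {\<omega> \<in> space M. N \<omega> = k} \<omega>) \<partial>M)"
  proof (rule nn_integral_cong)
    fix \<omega> assume "\<omega> \<in> space M"
    then have "(\<Sum>k. f k * indicator {\<omega> \<in> space M. N \<omega> = k} \<omega>) 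
      = (\<Sum>k\<in>{N \<omega>}. f k * indicator {\<omega> \<in> space M. N \<omega> = k} \<omega>)"
      by (intro suminf_finite) auto
    also have "\<dots> = f (N \<omega>)" using \<open>\<omega> \<in> space M\<close> by simp
    finally show "f (N \<omega>) = (\<Sum>k. f k * indicator {\<omega> \<in> space M. N \<omega> = k} \<omega>)" ..
  qed
  also have "\<dots> = (\<Sum>k. f k * emeasure M {\<omega> \<in> space M. N \<omega> = k})"
    by (subst nn_integral_suminf) (auto simp: nn_integral_cmult_indicator)
  finally show ?thesis .
qed

text \<open>Independence of a family includes measurability of its members, so a family with one
  element already yields it.\<close>

lemma (in prob_space) num_points_measurable:
  assumes "homogeneous_PPP M lam X" "B \<in> sets borel" "bounded B"
  shows "num_points X B \<in> measurable M (count_space UNIV)"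
proof -
  have "\<forall>n (B :: nat \<Rightarrow> (real ^ 2) set). (\<forall>k<n. B k \<in> sets borel \<and> bounded (B k)) \<longrightarrow>
      disjoint_family_on B {..<n} \<longrightarrow>
      indep_vars (\<lambda>_. count_space UNIV) (\<lambda>k. num_points X (B k)) {..<n}"
    using assms(1) by (auto simp: homogeneous_PPP_def)
  from this[rule_format, of 1 "\<lambda>_. B"] assms(2,3)
  have "indep_vars (\<lambda>_. count_space UNIV) (\<lambda>k. num_points X B) {..<1::nat}"
    by (auto simp: disjoint_family_on_def)
  then show ?thesis
    unfolding indep_vars_def by auto
qed

text \<open>Generating function exp (-m (1 - g)) of a Poisson variable with mean m, taken at
  \<open>g = eneg c\<close>. The value \<open>c = top\<close> is included and gives the void
  probability.\<close>

lemma (in prob_space) num_points_laplace: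
  assumes ppp: "homogeneous_PPP M lam X" and "0 \<le> lam" and B: "B \<in> sets borel" "bounded B"
  shows "(\<integral>\<^sup>+\<omega>. eneg (c * of_nat (num_points X B \<omega>)) \<partial>M) =
    eneg (ennreal lam * ((1 - eneg c) * emeasure lborel B))"
proof -
  define g where "g = enn2real (eneg c)"
  define m where "m = lam * measure lborel B"
  have g: "eneg c = ennreal g" "0 \<le> g" "g \<le> 1"
    using eneg_le_1[of c] by (auto simp: g_def enn2real_leI)
  have "emeasure lborel B < top"
    using emeasure_bounded_finite[OF B(2)] by (simp add: less_top)
  then have mB: "emeasure lborel B = ennreal (measure lborel B)"
    by (simp add: emeasure_eq_ennreal_measure less_top)
  have m: "0 \<le> m" using assms(2) by (simp add: m_def)
  note [measurable] = num_points_measurable[OF ppp B]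
  have "(\<integral>\<^sup>+\<omega>. eneg (c * of_nat (num_points X B \<omega>)) \<partial>M)
      = (\<integral>\<^sup>+\<omega>. ennreal g ^ num_points X B \<omega> \<partial>M)"
    by (simp add: mult.commute[of c] eneg_of_nat_mult g)
  also have "\<dots> = (\<Sum>k. ennreal g ^ k * emeasure M {\<omega> \<in> space M. num_points X B \<omega> = k})"
    by (rule nn_integral_nat_valued) measurable
  also have "\<dots> = (\<Sum>k. ennreal (exp (- m) * ((g * m) ^ k /\<^sub>R fact k)))"
  proof (rule suminf_cong)
    fix k
    have "prob {\<omega> \<in> space M. num_points X B \<omega> = k} = m ^ k / fact k * exp (- m)"
      using ppp B by (auto simp: homogeneous_PPP_def m_def)
    then show "ennreal g ^ k * emeasure M {\<omega> \<in> space M. num_points X B \<omega> = k} =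
        ennreal (exp (- m) * ((g * m) ^ k /\<^sub>R fact k))"
      using g m by (simp add: emeasure_eq_measure ennreal_power ennreal_mult'[symmetric]
          power_mult_distrib divide_simps)
  qed
  also have "\<dots> = ennreal (exp (- m) * exp (g * m))"
    using g m by (intro suminf_ennreal_eq sums_mult exp_converges) auto
  also have "\<dots> = eneg (ennreal (m * (1 - g)))"
    using g m by (subst eneg_ennreal) (simp_all add: exp_add[symmetric] algebra_simps mult_left_le_one_le)
  also have "ennreal (m * (1 - g)) = ennreal lam * ((1 - eneg c) * emeasure lborel B)"
    using g assms(2) by (simp add: m_def mB ennreal_mult' ennreal_minus[symmetric] ac_simps)
  finally show ?thesis .
qed

lemma suminf_indicator_eq_num_points:
  assumes "finite {i. X i \<omega> \<in> B}"
  shows "(\<Sum>i. indicator B (X i \<omega>) :: ennreal) = of_nat (num_points X B \<omega>)"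
proof -
  have "(\<Sum>i. indicator B (X i \<omega>) :: ennreal) = (\<Sum>i\<in>{i. X i \<omega> \<in> B}. indicator B (X i \<omega>))"
    using assms by (intro suminf_finite) auto
  then show ?thesis
    by (simp add: num_points_def)
qed

text \<open>The level sets of \<open>v\<close> at its nonzero values are bounded and disjoint. Their
  counts are therefore independent, and the sum over the points is a linear combination of these
  counts.\<close>

lemma (in prob_space) PPP_laplace_simple:
  assumes ppp: "homogeneous_PPP M lam X" and lam: "0 \<le> lam"
    and v: "simple_function borel v" and D: "bounded D" "\<And>x. x \<notin> D \<Longrightarrow> v x = 0"
  shows "(\<integral>\<^sup>+\<omega>. eneg (\<Sum>i. v (X i \<omega>)) \<partial>M) = eneg (ennreal lam * (\<integral>\<^sup>+x. 1 - eneg (v x) \<partial>lborel))"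
proof -
  \<comment> \<open>The value 0 is left out: its level set is unbounded, so its count is not
    described, and it contributes nothing to either side.\<close>
  have fin: "finite (range v - {0})"
    using simple_functionD(1)[OF v] by simp
  then obtain h where h: "bij_betw h {0..<card (range v - {0})} (range v - {0})"
    using ex_bij_betw_nat_finite by blast
  define n where "n = card (range v - {0})"
  define B where "B k = v -` {h k}" for k
  have h: "bij_betw h {..<n} (range v - {0})"
    using h by (simp add: n_def lessThan_atLeast0)
  have hk: "h k \<noteq> 0" if "k < n" for k
    using bij_betwE[OF h] that by auto
  have B: "B k \<in> sets borel" "bounded (B k)" if "k < n" for k
  proof -
    show "B k \<in> sets borel"
      using simple_functionD(2)[OF v, of "{h k}"] by (simp add: B_def)
    show "bounded (B k)"
      by (rule bounded_subset[OF D(1)]) (use D(2) hk[OF that] in \<open>force simp: B_def\<close>)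
  qed
  have disj: "disjoint_family_on B {..<n}"
    using bij_betw_imp_inj_on[OF h] by (auto simp: disjoint_family_on_def B_def inj_on_def)
  \<comment> \<open>Stated for every \<open>f\<close> vanishing at 0 because it serves twice: for
    the identity on the side of the points, and for \<open>1 - eneg y\<close> in the intensity
    integral.\<close>
  have sum: "f (v x) = (\<Sum>k<n. f (h k) * indicator (B k) x)" if "f 0 = 0" for f :: "ennreal \<Rightarrow> ennreal" and x
  proof (cases "v x = 0")
    case True
    then have "(\<Sum>k<n. f (h k) * indicator (B k) x) = 0"
      using hk by (intro sum.neutral) (auto simp: B_def indicator_def)
    with True that show ?thesis by simp
  next
    case False
    then have "v x \<in> h ` {..<n}"
      using h by (simp add: bij_betw_def)
    then obtain k where k: "k < n" "h k = v x"
      by auto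
    have "(\<Sum>k<n. f (h k) * indicator (B k) x) = (\<Sum>j\<in>{k}. f (h j) * indicator (B j) x)"
      using k bij_betw_imp_inj_on[OF h]
      by (intro sum.mono_neutral_right) (auto simp: B_def indicator_def inj_on_def)
    with k show ?thesis by (simp add: B_def)
  qed
  have ind: "indep_vars (\<lambda>_. count_space UNIV) (\<lambda>k. num_points X (B k)) {..<n}"
    using ppp B disj by (simp add: homogeneous_PPP_def)
  \<comment> \<open>Local finiteness identifies the sum of indicators with
    \<open>num_points\<close>; the \<open>card\<close> of an infinite index set would be 0.\<close>
  have "AE \<omega> in M. \<forall>B. bounded B \<longrightarrow> finite {i. X i \<omega> \<in> B}"
    using ppp by (simp add: homogeneous_PPP_def)
  then have "AE \<omega> in M. eneg (\<Sum>i. v (X i \<omega>)) = (\<Prod>k<n. eneg (h k * of_nat (num_points X (B k) \<omega>)))"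
  proof eventually_elim
    case (elim \<omega>)
    have "(\<Sum>i. v (X i \<omega>)) = (\<Sum>i. \<Sum>k<n. h k * indicator (B k) (X i \<omega>))"
      using sum[of "\<lambda>x. x"] by simp
    also have "\<dots> = (\<Sum>k<n. \<Sum>i. h k * indicator (B k) (X i \<omega>))"
      by (intro suminf_sum summableI)
    also have "\<dots> = (\<Sum>k<n. h k * of_nat (num_points X (B k) \<omega>))"
      using elim B(2) by (simp add: suminf_indicator_eq_num_points)
    finally show ?case by (simp add: eneg_sum)
  qed
  then have "(\<integral>\<^sup>+\<omega>. eneg (\<Sum>i. v (X i \<omega>)) \<partial>M) =
      (\<integral>\<^sup>+\<omega>. (\<Prod>k<n. eneg (h k * of_nat (num_points X (B k) \<omega>))) \<partial>M)"
    by (rule nn_integral_cong_AE)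
  also have "\<dots> = (\<Prod>k<n. \<integral>\<^sup>+\<omega>. eneg (h k * of_nat (num_points X (B k) \<omega>)) \<partial>M)"
    by (intro indep_vars_nn_integral indep_vars_compose2[OF ind, where Y = "\<lambda>k m. eneg (h k * of_nat m)"]) auto
  also have "\<dots> = (\<Prod>k<n. eneg (ennreal lam * ((1 - eneg (h k)) * emeasure lborel (B k))))"
    by (intro prod.cong refl num_points_laplace ppp lam B) auto
  also have "\<dots> = eneg (ennreal lam * (\<Sum>k<n. (1 - eneg (h k)) * emeasure lborel (B k)))"
    by (simp add: eneg_sum sum_distrib_left)
  also have "(\<Sum>k<n. (1 - eneg (h k)) * emeasure lborel (B k)) = 
      (\<Sum>k<n. \<integral>\<^sup>+x. (1 - eneg (h k)) * indicator (B k) x \<partial>lborel)"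
    using B by (intro sum.cong refl nn_integral_cmult_indicator[symmetric]) auto
  also have "\<dots> = (\<integral>\<^sup>+x. (\<Sum>k<n. (1 - eneg (h k)) * indicator (B k) x) \<partial>lborel)"
    using B by (intro nn_integral_sum[symmetric]) auto
  also have "\<dots> = (\<integral>\<^sup>+x. 1 - eneg (v x) \<partial>lborel)"
    using sum[of "\<lambda>y. 1 - eneg y"] by simp
  finally show ?thesis .
qed

lemma suminf_SUP_ennreal:
  fixes f :: "nat \<Rightarrow> nat \<Rightarrow> ennreal"
  assumes "\<And>i. incseq (\<lambda>n. f n i)"
  shows "(SUP n. \<Sum>i. f n i) = (\<Sum>i. SUP n. f n i)"
  using assms by (intro ennreal_suminf_SUP_eq[symmetric])

lemma (in prob_space) PPP_laplace:
  assumes ppp: "homogeneous_PPP M lam X" and lam: "0 \<le> lam"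
    and u [measurable]: "u \<in> borel_measurable borel"
  shows "(\<integral>\<^sup>+\<omega>. eneg (\<Sum>i. u (X i \<omega>)) \<partial>M) = eneg (ennreal lam * (\<integral>\<^sup>+x. 1 - eneg (u x) \<partial>lborel))"
proof -
  have [measurable]: "X i \<in> borel_measurable M" for i
    using ppp by (simp add: homogeneous_PPP_def)
  obtain f where f: "\<And>n. simple_function borel (f n)" "incseq f" "\<And>x. (SUP n. f n x) = u x"
    using borel_measurable_implies_simple_function_sequence'[OF u] by metis
  have [measurable]: "f n \<in> borel_measurable borel" for n
    using f(1) by (rule borel_measurable_simple_function)
  \<comment> \<open>The balls make the supports bounded, as the simple case demands; their radii
    grow with \<open>n\<close>, so the approximation stays increasing with limit
    \<open>u\<close>.\<close>
  define v where "v n x = f n x * indicator (ball 0 (real n)) x" for n x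
  have v_simple: "simple_function borel (v n)" for n
    unfolding v_def by (intro simple_function_mult f(1) simple_function_indicator) auto
  have [measurable]: "v n \<in> borel_measurable borel" for n
    using v_simple by (rule borel_measurable_simple_function)
  have v_inc: "incseq (\<lambda>n. v n x)" for x
    unfolding v_def using f(2)
    by (auto intro!: incseq_SucI mult_mono simp: incseq_Suc_iff le_fun_def indicator_def)
  have v_sup: "(SUP n. v n x) = u x" for x
  proof (rule LIMSEQ_unique[OF LIMSEQ_SUP[OF v_inc]])
    have "(\<lambda>n. f n x) \<longlonglongrightarrow> u x"
      unfolding f(3)[symmetric] using f(2)
      by (intro LIMSEQ_SUP) (auto simp: incseq_def le_fun_def)
    moreover have "eventually (\<lambda>n. f n x = v n x) sequentially"
    proof -
      obtain m where "norm x < real m" using reals_Archimedean2 by blast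
      then show ?thesis
        by (intro eventually_sequentiallyI[of m]) (auto simp: v_def)
    qed
    ultimately show "(\<lambda>n. v n x) \<longlonglongrightarrow> u x"
      by (rule Lim_transform_eventually)
  qed
  have "(\<lambda>n. \<integral>\<^sup>+\<omega>. eneg (\<Sum>i. v n (X i \<omega>)) \<partial>M) \<longlonglongrightarrow> (\<integral>\<^sup>+\<omega>. eneg (SUP n. \<Sum>i. v n (X i \<omega>)) \<partial>M)"
    using v_inc by (intro nn_integral_eneg_tendsto LIMSEQ_SUP) (auto simp: incseq_def intro!: suminf_le)
  also have "(\<integral>\<^sup>+\<omega>. eneg (SUP n. \<Sum>i. v n (X i \<omega>)) \<partial>M) = (\<integral>\<^sup>+\<omega>. eneg (\<Sum>i. u (X i \<omega>)) \<partial>M)"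
    using v_inc by (simp add: suminf_SUP_ennreal v_sup)
  also have "(\<lambda>n. \<integral>\<^sup>+\<omega>. eneg (\<Sum>i. v n (X i \<omega>)) \<partial>M) =
      (\<lambda>n. eneg (ennreal lam * (\<integral>\<^sup>+x. 1 - eneg (v n x) \<partial>lborel)))"
  proof
    fix n show "(\<integral>\<^sup>+\<omega>. eneg (\<Sum>i. v n (X i \<omega>)) \<partial>M) = eneg (ennreal lam * (\<integral>\<^sup>+x. 1 - eneg (v n x) \<partial>lborel))"
      by (rule PPP_laplace_simple[OF ppp lam v_simple bounded_ball[of 0 "real n"]]) (auto simp: v_def)
  qed
  finally have lim1: "(\<lambda>n. eneg (ennreal lam * (\<integral>\<^sup>+x. 1 - eneg (v n x) \<partial>lborel)))
      \<longlonglongrightarrow> (\<integral>\<^sup>+\<omega>. eneg (\<Sum>i. u (X i \<omega>)) \<partial>M)" .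
  have "(\<lambda>n. \<integral>\<^sup>+x. 1 - eneg (v n x) \<partial>lborel) \<longlonglongrightarrow> (\<integral>\<^sup>+x. 1 - eneg (u x) \<partial>lborel)"
  proof (rule nn_integral_LIMSEQ)
    show "incseq (\<lambda>n x. 1 - eneg (v n x))"
      using v_inc by (auto simp: incseq_def le_fun_def intro!: ennreal_minus_mono eneg_antimono)
    show "(\<lambda>n. 1 - eneg (v n x)) \<longlonglongrightarrow> 1 - eneg (u x)" for x
      unfolding v_sup[symmetric] by (intro tendsto_intros tendsto_eneg LIMSEQ_SUP v_inc) auto
  qed auto
  then have "(\<lambda>n. eneg (ennreal lam * (\<integral>\<^sup>+x. 1 - eneg (v n x) \<partial>lborel)))
      \<longlonglongrightarrow> eneg (ennreal lam * (\<integral>\<^sup>+x. 1 - eneg (u x) \<partial>lborel))"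
    by (intro tendsto_eneg ennreal_tendsto_cmult) auto
  with lim1 show ?thesis by (rule LIMSEQ_unique)
qed

section \<open>Independent marks\<close>

text \<open>Each \<open>E i\<close> is closed under intersection, so disjoint blocks of indices
  generate independent sigma-algebras. Two variables, each determined by one block, then have a
  product as joint law.\<close>

lemma (in prob_space) distr_blocks:
  assumes indep: "indep_sets E UNIV" and stable: "\<And>i. Int_stable (E i)" and "I \<inter> J = {}"
    and W: "W \<in> measurable (sigma (space M) (\<Union>i\<in>I. E i)) S"
    and V: "V \<in> measurable (sigma (space M) (\<Union>i\<in>J. E i)) T"
  shows "random_variable S W" "random_variable T V"
    and "distr M S W \<Otimes>\<^sub>M distr M T V = distr M (S \<Otimes>\<^sub>M T) (\<lambda>\<omega>. (W \<omega>, V \<omega>))"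
proof -
  have ev: "E i \<subseteq> events" for i
    using indep by (auto simp: indep_sets_def)
  then have Pow: "(\<Union>i\<in>K. E i) \<subseteq> Pow (space M)" and evK: "(\<Union>i\<in>K. E i) \<subseteq> events" for K
    using sets.space_closed by blast+
  have sub: "sigma_sets (space M) (\<Union>i\<in>K. E i) \<subseteq> events" for K
    using evK by (rule sets.sigma_sets_subset)
  define F where "F b = (\<Union>i\<in>case_bool I J b. E i)" for b
  have "indep_sets (\<lambda>b. sigma_sets (space M) (F b)) UNIV"
    unfolding F_def
    by (rule indep_sets_collect_sigma)
       (use \<open>I \<inter> J = {}\<close> in \<open>auto intro: indep_sets_mono_index[OF _ indep] stable
          simp: disjoint_family_on_def split: bool.splits\<close>)
  then have ind: "indep_set (sigma_sets (space M) (F True)) (sigma_sets (space M) (F False))"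
    unfolding indep_set_def by (elim indep_sets_mono_sets) (auto split: bool.splits)
  have W': "W -` A \<inter> space M \<in> sigma_sets (space M) (F True)" if "A \<in> sets S" for A
    using measurable_sets[OF W that] sets_measure_of[OF Pow[of I]] space_measure_of[OF Pow[of I]]
    by (simp add: F_def)
  have V': "V -` A \<inter> space M \<in> sigma_sets (space M) (F False)" if "A \<in> sets T" for A
    using measurable_sets[OF V that] sets_measure_of[OF Pow[of J]] space_measure_of[OF Pow[of J]]
    by (simp add: F_def)
  show [measurable]: "random_variable S W" "random_variable T V"
    using W V sub[of I] sub[of J]
    by (auto simp: measurable_def sets_measure_of[OF Pow] space_measure_of[OF Pow])
  interpret W: prob_space "distr M S W" by (rule prob_space_distr) fact
  interpret V: prob_space "distr M T V" by (rule prob_space_distr) fact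
  show "distr M S W \<Otimes>\<^sub>M distr M T V = distr M (S \<Otimes>\<^sub>M T) (\<lambda>\<omega>. (W \<omega>, V \<omega>))"
  proof (rule pair_measure_eqI)
    fix A B assume "A \<in> sets (distr M S W)" "B \<in> sets (distr M T V)"
    then have [measurable]: "A \<in> sets S" "B \<in> sets T" by auto
    have "emeasure (distr M (S \<Otimes>\<^sub>M T) (\<lambda>\<omega>. (W \<omega>, V \<omega>))) (A \<times> B)
        = emeasure M ((W -` A \<inter> space M) \<inter> (V -` B \<inter> space M))"
      by (subst emeasure_distr) (auto intro!: arg_cong[where f = "emeasure M"])
    also have "\<dots> = emeasure M (W -` A \<inter> space M) * emeasure M (V -` B \<inter> space M)"
      using indep_setD[OF ind W' V', of A B] by (simp add: emeasure_eq_measure ennreal_mult')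
    finally show "emeasure (distr M S W) A * emeasure (distr M T V) B =
        emeasure (distr M (S \<Otimes>\<^sub>M T) (\<lambda>\<omega>. (W \<omega>, V \<omega>))) (A \<times> B)"
      by (simp add: emeasure_distr)
  qed (auto intro: W.sigma_finite_measure_axioms V.sigma_finite_measure_axioms)
qed

lemma (in prob_space) nn_integral_blocks:
  assumes indep: "indep_sets E UNIV" "\<And>i. Int_stable (E i)" "I \<inter> J = {}"
    and W: "W \<in> measurable (sigma (space M) (\<Union>i\<in>I. E i)) S"
    and V: "V \<in> measurable (sigma (space M) (\<Union>i\<in>J. E i)) T"
    and f [measurable]: "f \<in> borel_measurable (S \<Otimes>\<^sub>M T)"
  shows "(\<integral>\<^sup>+\<omega>. f (W \<omega>, V \<omega>) \<partial>M) = (\<integral>\<^sup>+\<omega>. (\<integral>\<^sup>+v. f (W \<omega>, v) \<partial>distr M T V) \<partial>M)"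
proof -
  note [measurable] = distr_blocks(1,2)[OF indep W V]
  interpret V: prob_space "distr M T V"
    by (rule prob_space_distr) measurable
  have "(\<integral>\<^sup>+\<omega>. f (W \<omega>, V \<omega>) \<partial>M) = (\<integral>\<^sup>+z. f z \<partial>(distr M S W \<Otimes>\<^sub>M distr M T V))"
    by (simp add: distr_blocks(3)[OF indep W V] nn_integral_distr)
  also have "\<dots> = (\<integral>\<^sup>+w. \<integral>\<^sup>+v. f (w, v) \<partial>distr M T V \<partial>distr M S W)"
    by (rule V.nn_integral_fst[symmetric]) simp
  also have "\<dots> = (\<integral>\<^sup>+\<omega>. (\<integral>\<^sup>+v. f (W \<omega>, v) \<partial>distr M T V) \<partial>M)"
    by (rule nn_integral_distr) measurable
  finally show ?thesis .
qed

lemma measurable_sigma_mono: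
  assumes "f \<in> measurable (sigma \<Omega> A) N" "A \<subseteq> B" "B \<subseteq> Pow \<Omega>"
  shows "f \<in> measurable (sigma \<Omega> B) N"
proof -
  have "sets (sigma \<Omega> A) \<subseteq> sets (sigma \<Omega> B)"
    using assms by (simp add: sigma_sets_mono')
  then show ?thesis
    using assms by (auto simp: measurable_def)
qed

text \<open>Induction on the number of marks. The last mark is independent of everything else in the
  integrand and can be averaged out. Its average depends only on the position \<open>Z n\<close>,
  which the block \<open>I\<close> determines because it contains \<open>p\<close>. The average is
  thus absorbed into \<open>A\<close>, which is why \<open>A\<close> is arbitrary in the
  induction.\<close>

lemma (in prob_space) nn_integral_marks:
  fixes Z :: "nat \<Rightarrow> 'a \<Rightarrow> real ^ 2" and G :: "nat \<Rightarrow> 'a \<Rightarrow> real"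
  assumes indep: "indep_sets E UNIV" and stable: "\<And>i. Int_stable (E i)"
    and Z: "\<And>i. Z i \<in> borel_measurable (sigma (space M) (E p))"
    and G: "\<And>i. G i \<in> borel_measurable (sigma (space M) (E (q i)))"
    and L: "\<And>i. distr M borel (G i) = L"
    and q: "inj q" and I: "p \<in> I" "I \<inter> range q = {}"
    and A: "A \<in> borel_measurable (sigma (space M) (\<Union>i\<in>I. E i))"
    and g [measurable]: "(\<lambda>(x, m). g x m) \<in> borel_measurable (borel \<Otimes>\<^sub>M borel)"
  shows "(\<integral>\<^sup>+\<omega>. A \<omega> * (\<Prod>i<n. g (Z i \<omega>) (G i \<omega>)) \<partial>M)
       = (\<integral>\<^sup>+\<omega>. A \<omega> * (\<Prod>i<n. \<integral>\<^sup>+m. g (Z i \<omega>) m \<partial>L) \<partial>M)"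
  using A
proof (induction n arbitrary: A)
  case (Suc n)
  define blk where "blk K = sigma (space M) (\<Union>i\<in>K. E i)" for K
  have "E i \<subseteq> events" for i
    using indep by (auto simp: indep_sets_def)
  then have Pow: "(\<Union>i\<in>K. E i) \<subseteq> Pow (space M)" for K
    using sets.space_closed by blast
  have mono: "f \<in> borel_measurable (blk K')" if "f \<in> borel_measurable (blk K)" "K \<subseteq> K'"
    for f :: "'a \<Rightarrow> 'z :: topological_space" and K K'
    using that Pow unfolding blk_def by (elim measurable_sigma_mono) auto
  have Z': "Z i \<in> borel_measurable (blk {p})" and G': "G i \<in> borel_measurable (blk {q i})" for i
    using Z G by (auto simp: blk_def)
  \<comment> \<open>All sources of the remaining factors. As \<open>q\<close> is injective and its
    range avoids \<open>I\<close>, the source \<open>q n\<close> is not among them.\<close>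
  define K where "K = I \<union> q ` {..<n}"
  have [measurable]: "Z i \<in> borel_measurable (blk K)" for i
    by (rule mono[OF Z']) (use I in \<open>auto simp: K_def\<close>)
  have G'' [measurable]: "G i \<in> borel_measurable (blk K)" if "i < n" for i
    by (rule mono[OF G']) (use that in \<open>auto simp: K_def\<close>)
  have [measurable]: "A \<in> borel_measurable (blk K)"
    by (rule mono[of _ I]) (use Suc.prems in \<open>auto simp: K_def blk_def\<close>)
  have prod_meas: "(\<lambda>\<omega>. \<Prod>i<n. g (Z i \<omega>) (G i \<omega>)) \<in> borel_measurable (blk K)"
  proof (rule borel_measurable_prod_ennreal)
    fix i assume "i \<in> {..<n}"
    then have [measurable]: "G i \<in> borel_measurable (blk K)" by (intro G'') simp
    show "(\<lambda>\<omega>. g (Z i \<omega>) (G i \<omega>)) \<in> borel_measurable (blk K)" by measurable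
  qed
  note [measurable] = prod_meas
  have W: "(\<lambda>\<omega>. (A \<omega> * (\<Prod>i<n. g (Z i \<omega>) (G i \<omega>)), Z n \<omega>)) \<in> measurable (blk K) (borel \<Otimes>\<^sub>M borel)"
    by measurable
  have rv: "random_variable borel (G n)"
    using I by (intro distr_blocks(2)[OF indep stable _ W[unfolded blk_def], of "{q n}"]) (use q G' in \<open>auto simp: K_def blk_def dest: injD\<close>)
  have "(\<integral>\<^sup>+\<omega>. (case ((A \<omega> * (\<Prod>i<n. g (Z i \<omega>) (G i \<omega>)), Z n \<omega>), G n \<omega>) of ((a, z), m) \<Rightarrow> a * g z m) \<partial>M) =
      (\<integral>\<^sup>+\<omega>. (\<integral>\<^sup>+m. (case ((A \<omega> * (\<Prod>i<n. g (Z i \<omega>) (G i \<omega>)), Z n \<omega>), m) of ((a, z), m) \<Rightarrow> a * g z m)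
         \<partial>distr M borel (G n)) \<partial>M)"
    using I by (intro nn_integral_blocks[OF indep stable _ W[unfolded blk_def], of "{q n}"])
      (use q G' in \<open>auto simp: K_def blk_def dest: injD\<close>)
  then have "(\<integral>\<^sup>+\<omega>. A \<omega> * (\<Prod>i<n. g (Z i \<omega>) (G i \<omega>)) * g (Z n \<omega>) (G n \<omega>) \<partial>M) =
      (\<integral>\<^sup>+\<omega>. (\<integral>\<^sup>+m. A \<omega> * (\<Prod>i<n. g (Z i \<omega>) (G i \<omega>)) * g (Z n \<omega>) m \<partial>L) \<partial>M)"
    by (simp add: L)
  also have "\<dots> = (\<integral>\<^sup>+\<omega>. (A \<omega> * (\<integral>\<^sup>+m. g (Z n \<omega>) m \<partial>L)) * (\<Prod>i<n. g (Z i \<omega>) (G i \<omega>)) \<partial>M)"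
    unfolding L[of n, symmetric] by (subst nn_integral_cmult) (auto simp: ac_simps)
  also have "\<dots> = (\<integral>\<^sup>+\<omega>. (A \<omega> * (\<integral>\<^sup>+m. g (Z n \<omega>) m \<partial>L)) * (\<Prod>i<n. \<integral>\<^sup>+m. g (Z i \<omega>) m \<partial>L) \<partial>M)"
  proof (rule Suc.IH)
    interpret L: prob_space L
      unfolding L[of n, symmetric] by (rule prob_space_distr) fact
    have [measurable_cong]: "sets L = sets borel"
      unfolding L[of n, symmetric] by simp
    have [measurable]: "Z n \<in> borel_measurable (blk I)"
      by (rule mono[OF Z']) (use I in auto)
    have [measurable]: "A \<in> borel_measurable (blk I)"
      using Suc.prems by (simp add: blk_def)
    show "(\<lambda>\<omega>. A \<omega> * (\<integral>\<^sup>+m. g (Z n \<omega>) m \<partial>L)) \<in> borel_measurable (sigma (space M) (\<Union>i\<in>I. E i))"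
      unfolding blk_def[symmetric] by measurable
  qed
  finally show ?case by (simp add: ac_simps)
qed simp

section \<open>Laplace functional of the two marked processes\<close>

context network_model begin

lemma source_events_subset: "source_events M X Y Fm Em s \<subseteq> events"
  using independent by (auto simp: indep_sets_def)

lemma source_events_Pow: "(\<Union>s\<in>K. source_events M X Y Fm Em s) \<subseteq> Pow (space M)"
  using source_events_subset sets.space_closed by blast

lemma source_events_stable: "Int_stable (source_events M X Y Fm Em s)"
  by (cases s) (auto simp: Int_stable_def)

lemma measurable_sources:
  "X i \<in> borel_measurable (sigma (space M) (source_events M X Y Fm Em BS_Points))"
  "Y i \<in> borel_measurable (sigma (space M) (source_events M X Y Fm Em Dev_Points))"
  "Fm i \<in> borel_measurable (sigma (space M) (source_events M X Y Fm Em (BS_Mark i)))"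
  "Em i \<in> borel_measurable (sigma (space M) (source_events M X Y Fm Em (Dev_Mark i)))"
proof -
  have sets: "sets (sigma (space M) (sets (vimage_algebra (space M) f N))) = sets (vimage_algebra (space M) f N)"
    for f :: "'a \<Rightarrow> 'z" and N :: "'z measure"
    by (metis sets.sigma_sets_eq sets_measure_of sets.space_closed space_vimage_algebra)
  have comp: "(\<lambda>\<omega>. f \<omega> i) \<in> borel_measurable (vimage_algebra (space M) f (Pi\<^sub>M UNIV (\<lambda>_. borel)))"
    for f :: "'a \<Rightarrow> nat \<Rightarrow> real ^ 2"
    by (rule measurable_compose[OF measurable_vimage_algebra1 measurable_component_singleton])
       (auto simp: space_PiM)
  show "X i \<in> borel_measurable (sigma (space M) (source_events M X Y Fm Em BS_Points))"
    using comp[of "\<lambda>\<omega> i. X i \<omega>"] by (simp add: sets cong: measurable_cong_sets)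
  show "Y i \<in> borel_measurable (sigma (space M) (source_events M X Y Fm Em Dev_Points))"
    using comp[of "\<lambda>\<omega> i. Y i \<omega>"] by (simp add: sets cong: measurable_cong_sets)
  show "Fm i \<in> borel_measurable (sigma (space M) (source_events M X Y Fm Em (BS_Mark i)))"
    by (simp add: sets measurable_vimage_algebra1 cong: measurable_cong_sets)
  show "Em i \<in> borel_measurable (sigma (space M) (source_events M X Y Fm Em (Dev_Mark i)))"
    by (simp add: sets measurable_vimage_algebra1 cong: measurable_cong_sets)
qed

abbreviation "lawF \<equiv> distr M borel F"
abbreviation "lawE \<equiv> density lborel (exponential_density 1)"

lemma lawF: "prob_space lawF" and distr_Fm: "distr M borel (Fm i) = lawF"
  and lawE: "prob_space lawE" and distr_Em: "distr M borel (Em j) = lawE"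
proof -
  show "prob_space lawF" using F_measurable by (rule prob_space_distr)
  show "distr M borel (Fm i) = lawF" by (rule Fm_distr)
  show "prob_space lawE" by (rule prob_space_exponential_density) simp
  have "distr M borel (Em j) = distr M lborel (Em j)" by (rule distr_cong) auto
  then show "distr M borel (Em j) = lawE"
    using Em_distr[of j] by (simp add: distributed_distr_eq_density)
qed

text \<open>The base station marks are averaged with the device product as bystander, then the
  device marks with the averaged base station product as bystander. What remains depends only on the
  two point sequences, which are independent. The products are finite because marks are removed one
  at a time.\<close>

lemma nn_integral_marked_processes:
  assumes [measurable]: "(\<lambda>(x, m). g x m) \<in> borel_measurable (borel \<Otimes>\<^sub>M borel)"
      "(\<lambda>(y, m). h y m) \<in> borel_measurable (borel \<Otimes>\<^sub>M borel)"
  shows "(\<integral>\<^sup>+\<omega>. (\<Prod>i<n. g (X i \<omega>) (Fm i \<omega>)) * (\<Prod>j<n. h (Y j \<omega>) (Em j \<omega>)) \<partial>M) =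
    (\<integral>\<^sup>+\<omega>. (\<Prod>i<n. \<integral>\<^sup>+m. g (X i \<omega>) m \<partial>lawF) \<partial>M) * (\<integral>\<^sup>+\<omega>. (\<Prod>j<n. \<integral>\<^sup>+m. h (Y j \<omega>) m \<partial>lawE) \<partial>M)"
    (is "?lhs = _")
proof -
  define E where "E = source_events M X Y Fm Em"
  define blk where "blk K = sigma (space M) (\<Union>s\<in>K. E s)" for K
  note indep = independent[folded E_def] source_events_stable[folded E_def]
  interpret F: prob_space lawF by (rule lawF)
  interpret E: prob_space lawE by (rule lawE)
  have mono: "f \<in> borel_measurable (blk K)" if "f \<in> borel_measurable (sigma (space M) (E s))" "s \<in> K"
    for f :: "'a \<Rightarrow> 'z :: topological_space" and s K
    using that source_events_Pow[of K] unfolding blk_def E_def by (elim measurable_sigma_mono) auto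
  note mX = mono[OF measurable_sources(1)[folded E_def]]
    and mY = mono[OF measurable_sources(2)[folded E_def]]
    and mEm = mono[OF measurable_sources(4)[folded E_def]]
  let ?A = "\<lambda>\<omega>. \<Prod>j<n. h (Y j \<omega>) (Em j \<omega>)"
  let ?B = "\<lambda>\<omega>. \<Prod>i<n. \<integral>\<^sup>+m. g (X i \<omega>) m \<partial>lawF"
  let ?C = "\<lambda>\<omega>. \<Prod>j<n. \<integral>\<^sup>+m. h (Y j \<omega>) m \<partial>lawE"
  have A: "?A \<in> borel_measurable (blk ({BS_Points, Dev_Points} \<union> range Dev_Mark))"
  proof (rule borel_measurable_prod_ennreal)
    fix j
    have [measurable]: "Y j \<in> borel_measurable (blk ({BS_Points, Dev_Points} \<union> range Dev_Mark))"
        "Em j \<in> borel_measurable (blk ({BS_Points, Dev_Points} \<union> range Dev_Mark))"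
      by (auto intro!: mY mEm)
    show "(\<lambda>\<omega>. h (Y j \<omega>) (Em j \<omega>)) \<in> borel_measurable (blk ({BS_Points, Dev_Points} \<union> range Dev_Mark))"
      by measurable
  qed
  have B: "?B \<in> borel_measurable (blk K)" if "BS_Points \<in> K" for K
  proof (rule borel_measurable_prod_ennreal)
    fix i
    have [measurable]: "X i \<in> borel_measurable (blk K)" using that by (rule mX)
    show "(\<lambda>\<omega>. \<integral>\<^sup>+m. g (X i \<omega>) m \<partial>lawF) \<in> borel_measurable (blk K)" by measurable
  qed
  have C: "?C \<in> borel_measurable (blk K)" if "Dev_Points \<in> K" for K
  proof (rule borel_measurable_prod_ennreal)
    fix i
    have [measurable]: "Y i \<in> borel_measurable (blk K)" using that by (rule mY)
    show "(\<lambda>\<omega>. \<integral>\<^sup>+m. h (Y i \<omega>) m \<partial>lawE) \<in> borel_measurable (blk K)" by measurable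
  qed
  have "?lhs = (\<integral>\<^sup>+\<omega>. ?A \<omega> * (\<Prod>i<n. g (X i \<omega>) (Fm i \<omega>)) \<partial>M)"
    by (simp add: mult.commute)
  also have "\<dots> = (\<integral>\<^sup>+\<omega>. ?A \<omega> * ?B \<omega> \<partial>M)"
    by (rule nn_integral_marks[OF indep, where p = BS_Points and q = BS_Mark
          and I = "{BS_Points, Dev_Points} \<union> range Dev_Mark"])
       (use A in \<open>auto simp: E_def blk_def measurable_sources distr_Fm inj_def simp del: source_events.simps\<close>)
  also have "\<dots> = (\<integral>\<^sup>+\<omega>. ?B \<omega> * ?A \<omega> \<partial>M)"
    by (simp add: mult.commute)
  also have "\<dots> = (\<integral>\<^sup>+\<omega>. ?B \<omega> * ?C \<omega> \<partial>M)"
    by (rule nn_integral_marks[OF indep, where p = Dev_Points and q = Dev_Mark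
          and I = "{BS_Points, Dev_Points}"])
       (use B[of "{BS_Points, Dev_Points}"] in
          \<open>auto simp: E_def blk_def measurable_sources distr_Em inj_def simp del: source_events.simps\<close>)
  also have "\<dots> = (\<integral>\<^sup>+\<omega>. (\<integral>\<^sup>+c. ?B \<omega> * c \<partial>distr M borel ?C) \<partial>M)"
    using nn_integral_blocks[OF indep, of "{BS_Points}" "{Dev_Points}" ?B borel ?C borel "\<lambda>(b, c). b * c"]
      B[of "{BS_Points}"] C[of "{Dev_Points}"]
    by (simp add: blk_def)
  also have "\<dots> = (\<integral>\<^sup>+\<omega>. ?B \<omega> \<partial>M) * (\<integral>\<^sup>+\<omega>. ?C \<omega> \<partial>M)"
  proof -
    have [measurable]: "X i \<in> borel_measurable M" "Y i \<in> borel_measurable M" for i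
      using base_stations devices by (auto simp: homogeneous_PPP_def)
    have [measurable]: "?B \<in> borel_measurable M" "?C \<in> borel_measurable M"
      by (auto intro!: borel_measurable_prod_ennreal)
    show ?thesis
      by (simp add: nn_integral_cmult nn_integral_multc nn_integral_distr)
  qed
  finally show ?thesis .
qed

text \<open>The marking theorem together with the independence of the two processes, expressed by
  Laplace functionals: the double integrals are taken against the intensities of position and mark.
  It is the limit of the identity for finite products.\<close>

lemma joint_laplace:
  assumes [measurable]: "(\<lambda>(x, m). u x m) \<in> borel_measurable (borel \<Otimes>\<^sub>M borel)"
      "(\<lambda>(y, m). v y m) \<in> borel_measurable (borel \<Otimes>\<^sub>M borel)"
    and lam: "0 \<le> lamB" "0 \<le> lamD"
  shows "(\<integral>\<^sup>+\<omega>. eneg ((\<Sum>i. u (X i \<omega>) (Fm i \<omega>)) + (\<Sum>j. v (Y j \<omega>) (Em j \<omega>))) \<partial>M) =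
    eneg (ennreal lamB * (\<integral>\<^sup>+x. \<integral>\<^sup>+m. 1 - eneg (u x m) \<partial>lawF \<partial>lborel)
        + ennreal lamD * (\<integral>\<^sup>+y. \<integral>\<^sup>+m. 1 - eneg (v y m) \<partial>lawE \<partial>lborel))"
proof -
  have points: "(\<lambda>n. \<integral>\<^sup>+\<omega>. (\<Prod>i<n. \<integral>\<^sup>+m. eneg (w (Z i \<omega>) m) \<partial>L) \<partial>M)
      \<longlonglongrightarrow> eneg (ennreal lam * (\<integral>\<^sup>+x. \<integral>\<^sup>+m. 1 - eneg (w x m) \<partial>L \<partial>lborel))"
    if ppp: "homogeneous_PPP M lam Z" and lam: "0 \<le> lam" and "prob_space L" and sets: "sets L = sets borel"
      and [measurable]: "(\<lambda>(x, m). w x m) \<in> borel_measurable (borel \<Otimes>\<^sub>M borel)"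
    for lam :: real and Z L and w :: "real ^ 2 \<Rightarrow> real \<Rightarrow> ennreal"
  proof -
    interpret L: prob_space L by fact
    have [measurable_cong]: "sets L = sets borel" by fact
    have [measurable]: "Z i \<in> borel_measurable M" for i
      using ppp by (simp add: homogeneous_PPP_def)
    \<comment> \<open>The mark average of the exponential at position \<open>x\<close>. As it lies
      in [0, 1], it is itself the exponential of \<open>eneg_inv (g x)\<close>, to which the
      functional of the unmarked process applies.\<close>
    define g where "g x = (\<integral>\<^sup>+m. eneg (w x m) \<partial>L)" for x
    have [measurable]: "g \<in> borel_measurable borel"
      unfolding g_def by measurable
    have g1: "g x \<le> 1" for x
    proof -
      have "g x \<le> (\<integral>\<^sup>+m. 1 \<partial>L)" unfolding g_def by (intro nn_integral_mono eneg_le_1)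
      then show ?thesis by (simp add: L.emeasure_space_1)
    qed
    have "(\<lambda>n. \<integral>\<^sup>+\<omega>. eneg (\<Sum>i<n. eneg_inv (g (Z i \<omega>))) \<partial>M)
        \<longlonglongrightarrow> (\<integral>\<^sup>+\<omega>. eneg (\<Sum>i. eneg_inv (g (Z i \<omega>))) \<partial>M)"
      by (intro nn_integral_eneg_tendsto summable_LIMSEQ summableI) auto
    also have "(\<integral>\<^sup>+\<omega>. eneg (\<Sum>i. eneg_inv (g (Z i \<omega>))) \<partial>M) =
        eneg (ennreal lam * (\<integral>\<^sup>+x. 1 - g x \<partial>lborel))"
      by (subst PPP_laplace[OF ppp lam]) (auto simp: eneg_eneg_inv g1)
    finally have "(\<lambda>n. \<integral>\<^sup>+\<omega>. (\<Prod>i<n. g (Z i \<omega>)) \<partial>M)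
        \<longlonglongrightarrow> eneg (ennreal lam * (\<integral>\<^sup>+x. 1 - g x \<partial>lborel))"
      by (simp add: eneg_sum eneg_eneg_inv g1)
    moreover have "1 - g x = (\<integral>\<^sup>+m. 1 - eneg (w x m) \<partial>L)" for x
      using g1[of x] unfolding g_def
      by (subst nn_integral_diff) (auto simp: eneg_le_1 L.emeasure_space_1 top_unique)
    ultimately show ?thesis
      by (simp add: g_def)
  qed
  have [measurable]: "X i \<in> borel_measurable M" "Y i \<in> borel_measurable M"
      "Fm i \<in> borel_measurable M" "Em i \<in> borel_measurable M" for i
    using base_stations devices Fm_measurable Em_distr[of i]
    by (auto simp: homogeneous_PPP_def distributed_def)
  have "(\<lambda>n. \<integral>\<^sup>+\<omega>. eneg ((\<Sum>i<n. u (X i \<omega>) (Fm i \<omega>)) + (\<Sum>j<n. v (Y j \<omega>) (Em j \<omega>))) \<partial>M)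
    \<longlonglongrightarrow> (\<integral>\<^sup>+\<omega>. eneg ((\<Sum>i. u (X i \<omega>) (Fm i \<omega>)) + (\<Sum>j. v (Y j \<omega>) (Em j \<omega>))) \<partial>M)"
    by (intro nn_integral_eneg_tendsto tendsto_add summable_LIMSEQ summableI) auto
  moreover have "(\<integral>\<^sup>+\<omega>. eneg ((\<Sum>i<n. u (X i \<omega>) (Fm i \<omega>)) + (\<Sum>j<n. v (Y j \<omega>) (Em j \<omega>))) \<partial>M) =
      (\<integral>\<^sup>+\<omega>. (\<Prod>i<n. \<integral>\<^sup>+m. eneg (u (X i \<omega>) m) \<partial>lawF) \<partial>M) *
      (\<integral>\<^sup>+\<omega>. (\<Prod>j<n. \<integral>\<^sup>+m. eneg (v (Y j \<omega>) m) \<partial>lawE) \<partial>M)" for n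
    using nn_integral_marked_processes[of "\<lambda>x m. eneg (u x m)" "\<lambda>y m. eneg (v y m)" n]
    by (simp add: eneg_add eneg_sum)
  moreover have "(\<lambda>n. (\<integral>\<^sup>+\<omega>. (\<Prod>i<n. \<integral>\<^sup>+m. eneg (u (X i \<omega>) m) \<partial>lawF) \<partial>M) *
      (\<integral>\<^sup>+\<omega>. (\<Prod>j<n. \<integral>\<^sup>+m. eneg (v (Y j \<omega>) m) \<partial>lawE) \<partial>M)) \<longlonglongrightarrow>
    eneg (ennreal lamB * (\<integral>\<^sup>+x. \<integral>\<^sup>+m. 1 - eneg (u x m) \<partial>lawF \<partial>lborel)) *
    eneg (ennreal lamD * (\<integral>\<^sup>+y. \<integral>\<^sup>+m. 1 - eneg (v y m) \<partial>lawE \<partial>lborel))"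
    by (intro tendsto_mult_ennreal points base_stations devices lam lawF lawE) auto
  ultimately show ?thesis
    by (simp add: eneg_add LIMSEQ_unique)
qed

end

section \<open>Power-law intensities\<close>

lemma nn_integral_Gamma_scaled:
  fixes b s :: real
  assumes "0 < b" "0 < s"
  shows "(\<integral>\<^sup>+q. ennreal (q powr (b - 1) * exp (- (s * q))) * indicator {0<..} q \<partial>lborel)
    = ennreal (Gamma b * s powr (- b))"
proof -
  let ?I = "\<integral>\<^sup>+q. ennreal (q powr (b - 1) * exp (- (s * q))) * indicator {0<..} q \<partial>lborel"
  have "ennreal (Gamma b) = (\<integral>\<^sup>+t. ennreal (indicator {0..} t * t powr (b - 1) / exp t) \<partial>lborel)"
    using assms by (simp add: Gamma_conv_nn_integral_real)
  also have "\<dots> = ennreal s * (\<integral>\<^sup>+q. ennreal (indicator {0..} (s * q) * (s * q) powr (b - 1) / exp (s * q)) \<partial>lborel)"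
    using assms by (subst nn_integral_real_affine[where c = s and t = 0]) auto
  also have "(\<integral>\<^sup>+q. ennreal (indicator {0..} (s * q) * (s * q) powr (b - 1) / exp (s * q)) \<partial>lborel)
      = (\<integral>\<^sup>+q. ennreal (s powr (b - 1)) * (ennreal (q powr (b - 1) * exp (- (s * q))) * indicator {0<..} q) \<partial>lborel)"
    using assms by (intro nn_integral_cong)
      (auto simp: indicator_def powr_mult ennreal_mult'[symmetric] exp_minus divide_inverse zero_le_mult_iff)
  also have "\<dots> = ennreal (s powr (b - 1)) * ?I"
    by (subst nn_integral_cmult) auto
  finally have "ennreal (s powr (- b)) * ennreal (Gamma b) =
      ennreal (s powr (- b) * (s * s powr (b - 1))) * ?I"
    using assms by (simp add: ennreal_mult' mult.assoc)
  also have "s powr (- b) * (s * s powr (b - 1)) = 1"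
    using assms powr_mult_base[of s "b - 1"] by (simp add: powr_minus)
  finally show ?thesis
    using assms by (simp add: ennreal_mult'[symmetric] mult.commute)
qed

text \<open>For positive \<open>a\<close> and \<alpha> the mass near 0 is infinite, so tails are
  taken above positive levels. These tails and the null set \<open>{0}\<close> together witness
  sigma-finiteness. The mass at \<open>top\<close> is left to the decay of the tails.\<close>

definition power_law :: "ennreal measure \<Rightarrow> real \<Rightarrow> real \<Rightarrow> bool" where
  "power_law \<mu> a \<alpha> \<longleftrightarrow> sets \<mu> = sets borel \<and> emeasure \<mu> {0} = 0 \<and>
     (\<forall>q>0. emeasure \<mu> {ennreal q<..} = ennreal (a * q powr (- \<alpha>)))"

lemma power_lawD:
  assumes "power_law \<mu> a \<alpha>"
  shows "sets \<mu> = sets borel" "emeasure \<mu> {0} = 0"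
    "0 < q \<Longrightarrow> emeasure \<mu> {ennreal q<..} = ennreal (a * q powr (- \<alpha>))"
  using assms by (auto simp: power_law_def)

lemma power_law_sigma_finite:
  assumes "power_law \<mu> a \<alpha>"
  shows "sigma_finite_measure \<mu>"
proof
  let ?A = "insert {0} (range (\<lambda>n. {ennreal (1 / real (Suc n))<..}))"
  have "\<exists>n. ennreal (1 / real (Suc n)) < x" if "x \<noteq> 0" for x
  proof (cases x)
    case (real r)
    with that have "0 < r" by auto
    then obtain n where "1 / real (Suc n) < r"
      using nat_approx_posE by (metis of_nat_Suc)
    with real show ?thesis by (auto simp: ennreal_less_iff)
  qed auto
  then have "\<Union>?A = space \<mu>"
    using sets_eq_imp_space_eq[OF power_lawD(1)[OF assms]] by fastforce
  moreover have "\<forall>B\<in>?A. emeasure \<mu> B \<noteq> \<infinity>"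
    using power_lawD(2)[OF assms] power_lawD(3)[OF assms, of "1 / real (Suc _)"] by auto
  ultimately show "\<exists>A. countable A \<and> A \<subseteq> sets \<mu> \<and> \<Union>A = space \<mu> \<and> (\<forall>a\<in>A. emeasure \<mu> a \<noteq> \<infinity>)"
    by (intro exI[of _ ?A]) (auto simp: power_lawD(1)[OF assms])
qed

text \<open>Layer-cake formula: the left side is the integral of its derivative over (0, p), also
  for \<open>p = top\<close>. After Fubini only the tails of the intensity remain.\<close>

lemma one_minus_eneg_layer:
  assumes "0 < s"
  shows "1 - eneg (ennreal s * p) = (\<integral>\<^sup>+q. ennreal (s * exp (- (s * q))) * indicator {0<..} q * indicator {ennreal q<..} p \<partial>lborel)"
proof (cases p)
  case (real r)
  have "(\<integral>\<^sup>+q. ennreal (s * exp (- (s * q))) * indicator {0<..} q * indicator {ennreal q<..} p \<partial>lborel)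
     = (\<integral>\<^sup>+q. ennreal (s * exp (- (s * q))) * indicator {0..r} q \<partial>lborel)"
  proof (rule nn_integral_cong_AE)
    show "AE q in lborel. ennreal (s * exp (- (s * q))) * indicator {0<..} q * indicator {ennreal q<..} p =
        ennreal (s * exp (- (s * q))) * indicator {0..r} q"
      using AE_lborel_singleton[of 0] AE_lborel_singleton[of r]
      by eventually_elim (use real in \<open>auto simp: indicator_def ennreal_less_iff\<close>)
  qed
  also have "\<dots> = ennreal (- exp (- (s * r)) - (- exp (- (s * 0))))"
    using real assms by (intro nn_integral_FTC_Icc) (auto intro!: derivative_eq_intros)
  also have "\<dots> = 1 - eneg (ennreal s * p)"
    using real assms by (simp add: eneg_ennreal ennreal_mult'[symmetric] ennreal_minus[symmetric])
  finally show ?thesis ..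
next
  case top
  have "(\<integral>\<^sup>+q. ennreal (s * exp (- (s * q))) * indicator {0<..} q * indicator {ennreal q<..} p \<partial>lborel)
     = (\<integral>\<^sup>+q. ennreal (s * exp (- (s * q))) * indicator {0..} q \<partial>lborel)"
  proof (rule nn_integral_cong_AE)
    show "AE q in lborel. ennreal (s * exp (- (s * q))) * indicator {0<..} q * indicator {ennreal q<..} p =
        ennreal (s * exp (- (s * q))) * indicator {0..} q"
      using AE_lborel_singleton[of 0] by eventually_elim (use top in \<open>auto simp: indicator_def\<close>)
  qed
  also have "\<dots> = ennreal (0 - (- exp (- (s * 0))))"
  proof (rule nn_integral_FTC_atLeast)
    have "filterlim (\<lambda>x. s * x) at_top at_top"
      using assms by (intro filterlim_tendsto_pos_mult_at_top[OF tendsto_const] filterlim_ident)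
    then have "((\<lambda>x. exp (- (s * x))) \<longlongrightarrow> 0) at_top"
      by (intro filterlim_compose[OF exp_at_bot]) (simp add: filterlim_uminus_at_top)
    from tendsto_minus[OF this] show "((\<lambda>x. - exp (- (s * x))) \<longlongrightarrow> 0) at_top"
      by simp
  qed (use assms in \<open>auto intro!: derivative_eq_intros\<close>)
  also have "\<dots> = 1 - eneg (ennreal s * p)"
    using top assms by (simp add: ennreal_mult_top)
  finally show ?thesis ..
qed

text \<open>The layer formula leaves the integral of a s q^(-\<alpha>) exp (-s q) over q, a Gamma
  integral with parameter \<open>1 - \<alpha>\<close>; it converges at 0 because \<alpha> <
  1.\<close>

lemma power_law_laplace:
  assumes law: "power_law \<mu> a \<alpha>" and "0 < a" "0 < \<alpha>" "\<alpha> < 1" "0 < s"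
  shows "(\<integral>\<^sup>+p. 1 - eneg (ennreal s * p) \<partial>\<mu>) = ennreal (a * Gamma (1 - \<alpha>) * s powr \<alpha>)"
proof -
  interpret \<mu>: sigma_finite_measure \<mu> using law by (rule power_law_sigma_finite)
  interpret pair_sigma_finite lborel \<mu> ..
  have [measurable_cong]: "sets \<mu> = sets borel" using law by (rule power_lawD)
  have "(\<integral>\<^sup>+p. 1 - eneg (ennreal s * p) \<partial>\<mu>) =
      (\<integral>\<^sup>+p. \<integral>\<^sup>+q. ennreal (s * exp (- (s * q))) * indicator {0<..} q * indicator {ennreal q<..} p \<partial>lborel \<partial>\<mu>)"
    using assms by (simp add: one_minus_eneg_layer)
  also have "\<dots> = (\<integral>\<^sup>+q. \<integral>\<^sup>+p. ennreal (s * exp (- (s * q))) * indicator {0<..} q * indicator {ennreal q<..} p \<partial>\<mu> \<partial>lborel)"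
  proof (rule Fubini')
    have "(\<lambda>(q, p). ennreal (s * exp (- (s * q))) * indicator {0<..} q * (if ennreal q < p then 1 else 0))
        \<in> borel_measurable (lborel \<Otimes>\<^sub>M \<mu>)"
      by measurable
    also have "(\<lambda>(q, p). ennreal (s * exp (- (s * q))) * indicator {0<..} q * (if ennreal q < p then 1 else 0))
      = (\<lambda>(q, p). ennreal (s * exp (- (s * q))) * indicator {0<..} q * indicator {ennreal q<..} p)"
      by (auto simp: indicator_def fun_eq_iff)
    finally show "(\<lambda>(q, p). ennreal (s * exp (- (s * q))) * indicator {0<..} q * indicator {ennreal q<..} p)
        \<in> borel_measurable (lborel \<Otimes>\<^sub>M \<mu>)" .
  qed
  also have "\<dots> = (\<integral>\<^sup>+q. ennreal (s * exp (- (s * q))) * indicator {0<..} q * emeasure \<mu> {ennreal q<..} \<partial>lborel)"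
    by (simp add: nn_integral_cmult_indicator)
  also have "\<dots> = (\<integral>\<^sup>+q. ennreal (a * s) * (ennreal (q powr ((1 - \<alpha>) - 1) * exp (- (s * q))) * indicator {0<..} q) \<partial>lborel)"
    using assms by (intro nn_integral_cong)
      (auto simp: indicator_def power_lawD(3)[OF law] ennreal_mult'[symmetric] ac_simps)
  also have "\<dots> = ennreal (a * s) * ennreal (Gamma (1 - \<alpha>) * s powr (- (1 - \<alpha>)))"
    using assms by (subst nn_integral_cmult) (use nn_integral_Gamma_scaled[of "1 - \<alpha>" s] in auto)
  also have "\<dots> = ennreal (a * Gamma (1 - \<alpha>) * s powr \<alpha>)"
    using assms powr_mult_base[of s "\<alpha> - 1"] by (simp add: ennreal_mult'[symmetric] ac_simps)
  finally show ?thesis .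
qed

section \<open>Intensity of the received powers\<close>

definition power_intensity :: "real \<Rightarrow> real \<Rightarrow> real \<Rightarrow> real measure \<Rightarrow> ennreal measure" where
  "power_intensity kappa beta lam L = density (distr (lborel \<Otimes>\<^sub>M L) borel
     (\<lambda>(x, m). ennreal m / ennreal (path_loss kappa beta x))) (\<lambda>_. ennreal lam)"

lemma path_loss_measurable [measurable]: "path_loss kappa beta \<in> borel_measurable borel"
  unfolding path_loss_def by measurable

lemma nn_integral_power_intensity:
  assumes "prob_space L" and sets: "sets L = sets borel" and f [measurable]: "f \<in> borel_measurable borel"
  shows "(\<integral>\<^sup>+p. f p \<partial>power_intensity kappa beta lam L) =
    ennreal lam * (\<integral>\<^sup>+x. \<integral>\<^sup>+m. f (ennreal m / ennreal (path_loss kappa beta x)) \<partial>L \<partial>lborel)"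
proof -
  interpret L: prob_space L by fact
  have [measurable_cong]: "sets L = sets borel" by fact
  show ?thesis
    unfolding power_intensity_def
    by (simp add: nn_integral_density nn_integral_cmult nn_integral_distr L.nn_integral_fst[symmetric])
qed

lemma emeasure_power_exceeds:
  assumes "0 < kappa" "0 < beta" "0 < q" "0 < m"
  shows "emeasure lborel {x :: real ^ 2. ennreal q < ennreal m / ennreal (path_loss kappa beta x)} =
    ennreal (pi / kappa\<^sup>2 * q powr (- 2 / beta) * m powr (2 / beta))"
proof -
  \<comment> \<open>The radius obtained by solving \<open>path_loss kappa beta x < m / q\<close> for
    the norm of \<open>x\<close>.\<close>
  define r where "r = (m / q) powr (1 / beta) / kappa"
  have r: "0 < r" using assms by (simp add: r_def)
  have "ennreal q < ennreal m / ennreal (path_loss kappa beta x) \<longleftrightarrow> norm x < r" for x :: "real ^ 2"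
  proof (cases "x = 0")
    case False
    then have "0 < path_loss kappa beta x"
      using assms by (simp add: path_loss_def)
    then have "ennreal q < ennreal m / ennreal (path_loss kappa beta x) \<longleftrightarrow> path_loss kappa beta x < m / q"
      using assms by (simp add: divide_ennreal ennreal_less_iff field_simps)
    also have "\<dots> \<longleftrightarrow> (kappa * norm x) powr beta < ((m / q) powr (1 / beta)) powr beta"
      using assms by (simp add: path_loss_def powr_powr)
    also have "\<dots> \<longleftrightarrow> kappa * norm x < (m / q) powr (1 / beta)"
      using assms powr_less_mono2[of beta "kappa * norm x" "(m / q) powr (1 / beta)"]
        powr_mono2[of beta "(m / q) powr (1 / beta)" "kappa * norm x"]
      by (cases "kappa * norm x < (m / q) powr (1 / beta)") (auto simp: not_less)
    also have "\<dots> \<longleftrightarrow> norm x < r"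
      using assms by (simp add: r_def field_simps)
    finally show ?thesis .
  next
    \<comment> \<open>The path loss vanishes at the origin, and a positive mark divided by 0 is
      \<open>top\<close>, so the origin belongs to the disc.\<close>
    case True
    then have "ennreal m / ennreal (path_loss kappa beta x) = top"
      using assms(4) by (simp add: path_loss_def)
    then show ?thesis
      using True r by simp
  qed
  then have "{x :: real ^ 2. ennreal q < ennreal m / ennreal (path_loss kappa beta x)} = ball 0 r"
    by (intro set_eqI) (simp only: mem_Collect_eq mem_ball_0)
  then have "emeasure lborel {x :: real ^ 2. ennreal q < ennreal m / ennreal (path_loss kappa beta x)}
      = ennreal (pi * r\<^sup>2)"
    using r by (simp add: emeasure_ball unit_ball_vol_2)
  also have "r\<^sup>2 = (m / q) powr (2 / beta) / kappa\<^sup>2"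
    using assms by (simp add: r_def power_divide powr_power)
  also have "pi * \<dots> = pi / kappa\<^sup>2 * q powr (- 2 / beta) * m powr (2 / beta)"
  proof -
    have "q powr (- 2 / beta) = inverse (q powr (2 / beta))"
      using powr_minus[of q "2 / beta"] by simp
    then show ?thesis
      using assms by (simp add: powr_divide field_simps)
  qed
  finally show ?thesis .
qed

text \<open>For a fixed mark the positions received above level \<open>q\<close> form a disc with
  area proportional to \<open>m powr (2 / beta)\<close>. Integrating over the marks leaves only this
  one moment of their law.\<close>

lemma power_intensity_power_law:
  assumes "0 < kappa" "0 < beta" "0 \<le> lam" and "prob_space L" and sets: "sets L = sets borel"
    and pos: "AE m in L. 0 < m" and c: "(\<integral>\<^sup>+m. ennreal (m powr (2 / beta)) \<partial>L) = ennreal c" "0 \<le> c"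
  shows "power_law (power_intensity kappa beta lam L) (lam * pi * c / kappa\<^sup>2) (2 / beta)"
  unfolding power_law_def
proof (intro conjI allI impI)
  interpret L: prob_space L by fact
  interpret pair_sigma_finite lborel L ..
  have [measurable_cong]: "sets L = sets borel" by fact
  have setsI [simp]: "sets (power_intensity kappa beta lam L) = sets borel"
    by (simp add: power_intensity_def)
  then show "sets (power_intensity kappa beta lam L) = sets borel" .
  have em: "emeasure (power_intensity kappa beta lam L) A = ennreal lam *
      (\<integral>\<^sup>+m. emeasure lborel {x. ennreal m / ennreal (path_loss kappa beta x) \<in> A} \<partial>L)"
    if [measurable]: "A \<in> sets borel" for A
  proof -
    have sect: "(\<integral>\<^sup>+x. indicator A (ennreal m / ennreal (path_loss kappa beta x)) \<partial>lborel)
        = emeasure lborel {x. ennreal m / ennreal (path_loss kappa beta x) \<in> A}" for m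
    proof -
      have "(\<integral>\<^sup>+x. indicator A (ennreal m / ennreal (path_loss kappa beta x)) \<partial>lborel)
        = (\<integral>\<^sup>+x. indicator {x. ennreal m / ennreal (path_loss kappa beta x) \<in> A} x \<partial>lborel)"
        by (intro nn_integral_cong) (auto simp: indicator_def)
      then show ?thesis by simp
    qed
    have "emeasure (power_intensity kappa beta lam L) A = (\<integral>\<^sup>+p. indicator A p \<partial>power_intensity kappa beta lam L)"
      by simp
    also have "\<dots> = ennreal lam * (\<integral>\<^sup>+x. \<integral>\<^sup>+m. indicator A (ennreal m / ennreal (path_loss kappa beta x)) \<partial>L \<partial>lborel)"
      using assms by (intro nn_integral_power_intensity) auto
    also have "\<dots> = ennreal lam * (\<integral>\<^sup>+m. \<integral>\<^sup>+x. indicator A (ennreal m / ennreal (path_loss kappa beta x)) \<partial>lborel \<partial>L)"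
      by (subst Fubini') auto
    finally show ?thesis by (simp add: sect)
  qed
  \<comment> \<open>A positive mark yields a positive power at every distance, because the path loss
    is a finite number.\<close>
  have "(\<integral>\<^sup>+m. emeasure lborel {x. ennreal m / ennreal (path_loss kappa beta x) \<in> {0}} \<partial>L) = (\<integral>\<^sup>+m. 0 \<partial>L)"
    by (rule nn_integral_cong_AE) (use pos in \<open>eventually_elim, auto\<close>)
  then show "emeasure (power_intensity kappa beta lam L) {0} = 0"
    by (simp add: em)
  fix q :: real assume "0 < q"
  have "(\<integral>\<^sup>+m. emeasure lborel {x. ennreal m / ennreal (path_loss kappa beta x) \<in> {ennreal q<..}} \<partial>L)
      = (\<integral>\<^sup>+m. ennreal (pi / kappa\<^sup>2 * q powr (- 2 / beta)) * ennreal (m powr (2 / beta)) \<partial>L)"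
    by (rule nn_integral_cong_AE)
       (use pos in \<open>eventually_elim, use assms \<open>0 < q\<close> in \<open>auto simp: emeasure_power_exceeds ennreal_mult'[symmetric]\<close>\<close>)
  also have "\<dots> = ennreal (pi / kappa\<^sup>2 * q powr (- 2 / beta)) * ennreal c"
    by (subst nn_integral_cmult) (auto simp: c)
  finally show "emeasure (power_intensity kappa beta lam L) {ennreal q<..} =
      ennreal (lam * pi * c / kappa\<^sup>2 * q powr (- (2 / beta)))"
    using c(2) assms(3) by (simp add: em ennreal_mult'[symmetric] ac_simps)
qed

text \<open>The integrand has the antiderivative -exp (-c s^\<alpha>) / (c \<alpha>). It may be
  singular at 0, so the fundamental theorem is applied from 1 / (n + 1) onwards and the lower end is
  then sent to 0.\<close>

lemma nn_integral_stretched_exp: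
  assumes "0 < c" "0 < \<alpha>"
  shows "(\<integral>\<^sup>+s. ennreal (s powr (\<alpha> - 1) * exp (- (c * s powr \<alpha>))) * indicator {0<..} s \<partial>lborel) = ennreal (1 / (c * \<alpha>))"
proof -
  define f where "f s = s powr (\<alpha> - 1) * exp (- (c * s powr \<alpha>))" for s
  define F where "F s = - exp (- (c * s powr \<alpha>)) / (c * \<alpha>)" for s
  have [measurable]: "f \<in> borel_measurable borel" unfolding f_def by measurable
  have "filterlim (\<lambda>s::real. s powr \<alpha>) at_top at_top"
  proof -
    have "filterlim (\<lambda>s. exp (\<alpha> * ln s)) at_top at_top"
      using assms
      by (intro filterlim_compose[OF exp_at_top] filterlim_tendsto_pos_mult_at_top[OF tendsto_const] ln_at_top)
    moreover have "eventually (\<lambda>s. exp (\<alpha> * ln s) = s powr \<alpha>) at_top"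
      using eventually_gt_at_top[of "0 :: real"] by eventually_elim (simp add: powr_def)
    ultimately show ?thesis
      by (rule filterlim_cong[OF refl refl, THEN iffD1, rotated])
  qed
  then have "filterlim (\<lambda>s. c * s powr \<alpha>) at_top at_top"
    using assms by (intro filterlim_tendsto_pos_mult_at_top[OF tendsto_const])
  then have "((\<lambda>s. exp (- (c * s powr \<alpha>))) \<longlongrightarrow> 0) at_top"
    by (intro filterlim_compose[OF exp_at_bot]) (simp add: filterlim_uminus_at_top)
  from tendsto_divide_zero[OF tendsto_minus[OF this, simplified], of "c * \<alpha>"]
  have F_lim: "(F \<longlongrightarrow> 0) at_top"
    by (simp add: F_def[abs_def])
  have int: "(\<integral>\<^sup>+s. ennreal (f s) * indicator {1 / real (Suc n)..} s \<partial>lborel) = ennreal (0 - F (1 / real (Suc n)))" for n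
  proof (rule nn_integral_FTC_atLeast)
    fix s :: real assume "1 / real (Suc n) \<le> s"
    moreover have "0 < 1 / real (Suc n)" by simp
    ultimately have "0 < s" by linarith
    then show "(F has_real_derivative f s) (at s)"
      unfolding F_def f_def using assms
      by (auto intro!: derivative_eq_intros simp: field_simps)
    show "0 \<le> f s" by (simp add: f_def)
  qed (use F_lim in auto)
  have "(\<lambda>n. \<integral>\<^sup>+s. ennreal (f s) * indicator {1 / real (Suc n)..} s \<partial>lborel)
      \<longlonglongrightarrow> (\<integral>\<^sup>+s. ennreal (f s) * indicator {0<..} s \<partial>lborel)"
  proof (rule nn_integral_LIMSEQ)
    have "1 / real (Suc n) \<le> 1 / real (Suc m)" if "m \<le> n" for m n
      using that by (simp add: frac_le)
    then show "incseq (\<lambda>n s. ennreal (f s) * indicator {1 / real (Suc n)..} s)"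
      by (fastforce simp: incseq_def le_fun_def indicator_def)
    fix s :: real
    show "(\<lambda>n. ennreal (f s) * indicator {1 / real (Suc n)..} s) \<longlonglongrightarrow> ennreal (f s) * indicator {0<..} s"
    proof (cases "0 < s")
      case True
      then have "eventually (\<lambda>n. 1 / real (Suc n) < s) sequentially"
        by (intro order_tendstoD(2)[OF lim_1_over_n[THEN LIMSEQ_Suc]]) auto
      then show ?thesis
        using True by (intro tendsto_eventually) (auto elim!: eventually_mono)
    next
      case False
      then have "\<not> 1 / real (Suc n) \<le> s" for n
        by (smt (verit) divide_pos_pos of_nat_0_less_iff zero_less_Suc)
      with False show ?thesis by simp
    qed
  qed auto
  moreover have "(\<lambda>n. ennreal (0 - F (1 / real (Suc n)))) \<longlonglongrightarrow> ennreal (0 - (- exp (- (c * 0)) / (c * \<alpha>)))"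
  proof -
    have "(\<lambda>n. (1 / real (Suc n)) powr \<alpha>) \<longlonglongrightarrow> 0 powr \<alpha>"
      using assms by (intro tendsto_powr2 lim_1_over_n[THEN LIMSEQ_Suc]) auto
    then show ?thesis
      unfolding F_def using assms by (intro tendsto_intros) auto
  qed
  ultimately have "(\<integral>\<^sup>+s. ennreal (f s) * indicator {0<..} s \<partial>lborel) = ennreal (0 - (- exp (- (c * 0)) / (c * \<alpha>)))"
    unfolding int by (rule LIMSEQ_unique)
  then show ?thesis by (simp add: f_def)
qed

section \<open>Moments on the unit interval\<close>

text \<open>Uniqueness in the Hausdorff moment problem. The moments determine the integrals of
  polynomials, hence by Weierstrass those of continuous functions, hence those of indicators of open
  half-lines as limits of continuous ramps.\<close>

lemma moments_determine_measure:
  fixes M N :: "real measure"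
  assumes fin: "finite_measure M" "finite_measure N"
    and sets: "sets M = sets borel" "sets N = sets borel"
    and supp: "AE x in M. x \<in> {0..1}" "AE x in N. x \<in> {0..1}"
    and moments: "\<And>n. (\<integral>\<^sup>+x. ennreal (x ^ n) \<partial>M) = (\<integral>\<^sup>+x. ennreal (x ^ n) \<partial>N)"
  shows "M = N"
proof (rule measure_eqI_lessThan[OF sets])
  interpret M: finite_measure M by fact
  interpret N: finite_measure N by fact
  have [measurable_cong]: "sets M = sets borel" "sets N = sets borel" by fact+
  show "emeasure M {x<..} < \<infinity>" for x
    by (simp add: M.emeasure_eq_measure)
  have bounded_int: "integrable M f" "integrable N f"
    if [measurable]: "f \<in> borel_measurable borel" and "\<And>x. x \<in> {0..1} \<Longrightarrow> \<bar>f x\<bar> \<le> C" for f :: "real \<Rightarrow> real" and C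
  proof -
    have "AE x in M. norm (f x) \<le> C"
      using supp(1) by eventually_elim (simp add: that(2))
    then show "integrable M f"
      by (rule M.integrable_const_bound) simp
    have "AE x in N. norm (f x) \<le> C"
      using supp(2) by eventually_elim (simp add: that(2))
    then show "integrable N f"
      by (rule N.integrable_const_bound) simp
  qed
  have pow_int: "integrable M (\<lambda>x. x ^ n)" "integrable N (\<lambda>x. x ^ n)" for n
    by (rule bounded_int[where C = 1]; simp add: power_le_one)+
  have pow: "(\<integral>x. x ^ n \<partial>M) = (\<integral>x. x ^ n \<partial>N)" for n
  proof -
    have "AE x in M. 0 \<le> x ^ n" "AE x in N. 0 \<le> x ^ n"
      using supp by (auto elim!: eventually_mono)
    then show ?thesis
      using moments[of n] by (simp add: integral_eq_nn_integral)
  qed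
  have cont: "(\<integral>x. f x \<partial>M) = (\<integral>x. f x \<partial>N)" if f: "continuous_on UNIV f" for f :: "real \<Rightarrow> real"
  proof -
    have [measurable]: "f \<in> borel_measurable borel" using f by (rule borel_measurable_continuous_onI)
    have f01: "continuous_on {0..1} f" using f by (rule continuous_on_subset) simp
    have "bounded (f ` {0..1})"
      by (intro compact_imp_bounded compact_continuous_image f01 compact_Icc)
    then obtain C where C: "x \<in> {0..1} \<Longrightarrow> \<bar>f x\<bar> \<le> C" for x
      unfolding bounded_iff by force
    have f_int: "integrable M f" "integrable N f"
      by (rule bounded_int[where C = C], simp, erule C)+
    define K where "K = measure M (space M) + measure N (space N)"
    have close: "\<bar>(\<integral>x. f x \<partial>M) - (\<integral>x. f x \<partial>N)\<bar> \<le> e * K" if "0 < e" for e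
    proof -
      obtain g where g: "real_polynomial_function g" "\<And>x. x \<in> {0..1} \<Longrightarrow> \<bar>f x - g x\<bar> < e"
        using Stone_Weierstrass_real_polynomial_function[OF compact_Icc f01 \<open>0 < e\<close>] by blast
      then obtain a n where ga: "g = (\<lambda>x. \<Sum>i\<le>n. a i * x ^ i)"
        by (auto simp: real_polynomial_function_iff_sum)
      have g_int: "integrable M g" "integrable N g"
        unfolding ga by (auto intro!: pow_int)
      have geq: "(\<integral>x. g x \<partial>M) = (\<integral>x. g x \<partial>N)"
        unfolding ga using pow_int by (simp add: pow)
      have "\<bar>\<integral>x. f x - g x \<partial>M\<bar> \<le> (\<integral>x. e \<partial>M)"
      proof (rule order_trans[OF integral_abs_bound integral_mono_AE])
        show "integrable M (\<lambda>x. \<bar>f x - g x\<bar>)" using g_int f_int by simp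
        show "AE x in M. \<bar>f x - g x\<bar> \<le> e" using supp(1) by eventually_elim (intro less_imp_le g(2))
      qed simp
      moreover have "\<bar>\<integral>x. f x - g x \<partial>N\<bar> \<le> (\<integral>x. e \<partial>N)"
      proof (rule order_trans[OF integral_abs_bound integral_mono_AE])
        show "integrable N (\<lambda>x. \<bar>f x - g x\<bar>)" using g_int f_int by simp
        show "AE x in N. \<bar>f x - g x\<bar> \<le> e" using supp(2) by eventually_elim (intro less_imp_le g(2))
      qed simp
      ultimately show ?thesis
        using g_int f_int geq by (simp add: K_def algebra_simps)
    qed
    have "\<bar>(\<integral>x. f x \<partial>M) - (\<integral>x. f x \<partial>N)\<bar> \<le> 0"
    proof (rule field_le_epsilon)
      fix d :: real assume "0 < d"
      have K: "0 \<le> K" by (simp add: K_def)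
      \<comment> \<open>The \<open>+ 1\<close> covers the case that both measures are zero.\<close>
      have "\<bar>(\<integral>x. f x \<partial>M) - (\<integral>x. f x \<partial>N)\<bar> \<le> d / (K + 1) * K"
        using \<open>0 < d\<close> K by (intro close) auto
      also have "\<dots> \<le> d"
        using \<open>0 < d\<close> K by (simp add: field_simps)
      finally show "\<bar>(\<integral>x. f x \<partial>M) - (\<integral>x. f x \<partial>N)\<bar> \<le> 0 + d" by simp
    qed
    then show ?thesis by simp
  qed
  fix a :: real
  \<comment> \<open>For positive \<open>k\<close> the ramp climbs from 0 at \<open>a\<close> to 1 at
    distance \<open>1 / k\<close>. Since it vanishes at \<open>a\<close> itself, the limit is the
    indicator of the open half-line.\<close>
  define r where "r k x = max 0 (min 1 (real k * (x - a)))" for k x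
  have [measurable]: "r k \<in> borel_measurable borel" for k unfolding r_def by measurable
  have lim: "(\<lambda>k. r k x) \<longlonglongrightarrow> indicator {a<..} x" for x
  proof (cases "a < x")
    case True
    then obtain m where m: "1 / (x - a) < real m" using reals_Archimedean2 by blast
    have "1 \<le> real k * (x - a)" if "m \<le> k" for k
    proof -
      have "1 / (x - a) \<le> real k" using m that by linarith
      with True show ?thesis by (simp add: field_simps)
    qed
    then have "eventually (\<lambda>k. r k x = 1) sequentially"
      by (intro eventually_sequentiallyI[of m]) (simp add: r_def)
    then show ?thesis using True by (simp add: tendsto_eventually)
  next
    case False
    then have "real k * (x - a) \<le> 0" for k by (intro mult_nonneg_nonpos) auto
    then have "r k x = 0" for k by (simp add: r_def max_absorb1 min.coboundedI2)
    with False show ?thesis by simp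
  qed
  have "(\<lambda>k. \<integral>x. r k x \<partial>M) \<longlonglongrightarrow> (\<integral>x. indicator {a<..} x \<partial>M)"
    by (rule integral_dominated_convergence[where w = "\<lambda>_. 1"]) (use lim in \<open>auto simp: r_def\<close>)
  moreover have "(\<lambda>k. \<integral>x. r k x \<partial>N) \<longlonglongrightarrow> (\<integral>x. indicator {a<..} x \<partial>N)"
    by (rule integral_dominated_convergence[where w = "\<lambda>_. 1"]) (use lim in \<open>auto simp: r_def\<close>)
  moreover have "(\<integral>x. r k x \<partial>M) = (\<integral>x. r k x \<partial>N)" for k
    unfolding r_def by (intro cont continuous_intros)
  ultimately have "measure M {a<..} = measure N {a<..}"
    using LIMSEQ_unique by simp
  then show "emeasure M {a<..} = emeasure N {a<..}"
    by (simp add: M.emeasure_eq_measure N.emeasure_eq_measure)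
qed

section \<open>Mecke formula for the received powers\<close>

text \<open>The difference quotient of \<open>-eneg (t * x)\<close> between \<open>t = 0\<close> and \<open>t = 2 ^ - k\<close>; along powers of two
  it increases to \<open>x\<close>, which turns differentiation of Laplace functionals into monotone convergence.\<close>

definition dq :: "nat \<Rightarrow> ennreal \<Rightarrow> ennreal" where
  "dq k x = 2 ^ k * (1 - eneg (x / 2 ^ k))"

lemma ennreal_two_power: "(2 :: ennreal) ^ k = ennreal (2 ^ k)"
  by (simp add: ennreal_power[symmetric])

lemma dq_measurable [measurable]: "dq k \<in> borel_measurable borel"
  unfolding dq_def[abs_def] by measurable

text \<open>Raising \<open>k\<close> by one halves the argument, so the exponential
  \<open>y * y\<close> becomes its square root \<open>y\<close>. The claim reduces to
  \<open>1 - y * y \<le> 2 * (1 - y)\<close>, that is, to the square of \<open>1 - y\<close> being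
  nonnegative.\<close>

lemma dq_incseq: "incseq (\<lambda>k. dq k x)"
proof (rule incseq_SucI)
  fix k
  obtain y where y: "eneg (x / 2 ^ Suc k) = ennreal y" "0 \<le> y" "y \<le> 1"
    using eneg_le_1[of "x / 2 ^ Suc k"] by (cases "eneg (x / 2 ^ Suc k)") auto
  have "x / 2 ^ k = x / 2 ^ Suc k + x / 2 ^ Suc k"
  proof (cases x)
    case (real r)
    then show ?thesis
      unfolding ennreal_two_power by (simp add: divide_ennreal field_simps flip: ennreal_plus)
  next
    case top
    moreover have "2 * (2 :: ennreal) ^ k \<noteq> top" "(2 :: ennreal) ^ k \<noteq> top"
      using ennreal_two_power[of k] ennreal_two_power[of "Suc k"] by auto
    ultimately show ?thesis
      by (simp add: ennreal_top_divide)
  qed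
  then have "eneg (x / 2 ^ k) = ennreal (y * y)"
    using y by (simp add: eneg_add ennreal_mult')
  moreover have "1 - y * y \<le> 2 * (1 - y)"
    using zero_le_square[of "1 - y"] by (simp add: algebra_simps)
  moreover have "1 - ennreal (y * y) = ennreal (1 - y * y)"
    using y by (simp add: ennreal_minus flip: ennreal_1)
  moreover have "2 * (1 - ennreal y) = ennreal (2 * (1 - y))"
    using y ennreal_mult'[of 2 "1 - y"] by (simp add: ennreal_minus flip: ennreal_1)
  ultimately have "1 - eneg (x / 2 ^ k) \<le> 2 * (1 - eneg (x / 2 ^ Suc k))"
    using y by (simp add: ennreal_leI)
  then show "dq k x \<le> dq (Suc k) x"
    unfolding dq_def by (simp add: mult_left_mono mult.assoc mult.left_commute[of 2] )
qed

lemma dq_tendsto: "(\<lambda>k. dq k x) \<longlonglongrightarrow> x"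
proof (cases x)
  case (real r)
  have "(\<lambda>k. 2 ^ k * (1 - exp (- (r / 2 ^ k)))) \<longlonglongrightarrow> r"
    by real_asymp
  then have "(\<lambda>k. ennreal (2 ^ k * (1 - exp (- (r / 2 ^ k))))) \<longlonglongrightarrow> ennreal r"
    by (rule tendsto_ennrealI)
  moreover have "dq k x = ennreal (2 ^ k * (1 - exp (- (r / 2 ^ k))))" for k
    using real unfolding dq_def ennreal_two_power
    by (simp add: divide_ennreal eneg_ennreal ennreal_minus ennreal_mult' flip: ennreal_1)
  ultimately show ?thesis using real by simp
next
  case top
  have "(\<lambda>k. (2 :: ennreal) ^ k) \<longlonglongrightarrow> top"
    unfolding ennreal_two_power ennreal_tendsto_top_eq_at_top by real_asymp
  moreover have "(2 :: ennreal) ^ k \<noteq> top" for k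
    using ennreal_two_power[of k] by auto
  ultimately show ?thesis
    using top by (simp add: dq_def ennreal_top_divide)
qed

lemma dq_le: "dq k x \<le> x"
  using incseq_le[OF dq_incseq dq_tendsto] .

text \<open>Index and argument of the quotient vary together. For the lower bound an index
  \<open>m\<close> is frozen: \<open>dq m\<close> is continuous, and moving from \<open>m\<close> to
  a larger index only increases the value. The upper bound is \<open>dq k y \<le> y\<close>.\<close>

lemma dq_tendsto_diagonal:
  assumes "f \<longlonglongrightarrow> c" "\<And>k. f k \<le> c"
  shows "(\<lambda>k. dq k (f k)) \<longlonglongrightarrow> c"
proof (rule order_tendstoI)
  fix a assume "a < c"
  then have "eventually (\<lambda>m. a < dq m c) sequentially"
    using dq_tendsto by (rule order_tendstoD[rotated])
  then obtain m where m: "a < dq m c"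
    by (auto simp: eventually_sequentially)
  have "(\<lambda>k. dq m (f k)) \<longlonglongrightarrow> dq m c"
    unfolding dq_def divide_ennreal_def mult.commute[of _ "inverse _"]
    by (intro ennreal_tendsto_cmult tendsto_diff_ennreal tendsto_const tendsto_eneg assms(1))
       (auto simp: ennreal_two_power inverse_ennreal)
  then have "eventually (\<lambda>k. a < dq m (f k)) sequentially"
    using m by (rule order_tendstoD)
  then show "eventually (\<lambda>k. a < dq k (f k)) sequentially"
    using eventually_ge_at_top[of m]
  proof eventually_elim
    case (elim k)
    then show ?case using incseqD[OF dq_incseq, of m k "f k"] by simp
  qed
next
  fix a assume "c < a"
  moreover have "dq k (f k) \<le> c" for k
    using dq_le assms(2) by (rule order_trans)
  ultimately show "eventually (\<lambda>k. dq k (f k) < a) sequentially"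
    by (auto intro!: always_eventually intro: le_less_trans)
qed

text \<open>The point \<open>top\<close> lies in every tail, and the tails shrink to 0. This later
  makes the restriction to finite powers harmless on the intensity side.\<close>

lemma power_law_top:
  assumes law: "power_law \<mu> a \<alpha>" and "0 < \<alpha>"
  shows "emeasure \<mu> {top} = 0"
proof -
  have "emeasure \<mu> {top} \<le> ennreal (a * real (Suc n) powr (- \<alpha>))" for n
  proof -
    have "emeasure \<mu> {top} \<le> emeasure \<mu> {ennreal (real (Suc n))<..}"
      by (rule emeasure_mono) (auto simp: power_lawD(1)[OF law])
    then show ?thesis
      using power_lawD(3)[OF law, of "real (Suc n)"] by simp
  qed
  moreover have "(\<lambda>n. ennreal (a * real (Suc n) powr (- \<alpha>))) \<longlonglongrightarrow> ennreal (a * 0)"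
  proof (intro tendsto_ennrealI tendsto_mult tendsto_const)
    show "(\<lambda>n. real (Suc n) powr (- \<alpha>)) \<longlonglongrightarrow> 0"
      using \<open>0 < \<alpha>\<close> by real_asymp
  qed
  ultimately have "emeasure \<mu> {top} \<le> ennreal (a * 0)"
    by (intro LIMSEQ_le_const[where a = "emeasure \<mu> {top}"]) auto
  then show ?thesis by simp
qed

lemma ennreal_one_minus_mult:
  fixes a b :: ennreal
  assumes "a \<le> 1" "b \<le> 1"
  shows "1 - a * b = (1 - a) + a * (1 - b)"
proof -
  obtain r q where rq: "a = ennreal r" "b = ennreal q" "0 \<le> r" "r \<le> 1" "0 \<le> q" "q \<le> 1"
    using assms by (cases a; cases b) (auto simp: top_unique)
  then have "1 - a * b = ennreal (1 - r * q)" "1 - a = ennreal (1 - r)" "a * (1 - b) = ennreal (r * (1 - q))"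
    by (simp_all add: ennreal_minus flip: ennreal_1 ennreal_mult')
  moreover have "1 - r * q = (1 - r) + r * (1 - q)"
    by (simp add: algebra_simps)
  ultimately show ?thesis
    using rq by (simp flip: ennreal_plus)
qed

section \<open>Campbell's formula with an exponential weight\<close>

locale positive_network = network_model +
  fixes kappa :: real
  assumes beta: "2 < beta" and kappa: "0 < kappa" and lamB: "0 < lamB" and lamD: "0 < lamD"
begin

abbreviation "intensityB \<equiv> power_intensity kappa beta lamB lawF"
abbreviation "intensityD \<equiv> power_intensity kappa beta lamD lawE"
abbreviation "powerB \<equiv> received_power kappa beta X Fm"
abbreviation "powerD \<equiv> received_power kappa beta Y Em"
abbreviation "total_power \<omega> \<equiv> interference kappa beta X Fm \<omega> + interference kappa beta Y Em \<omega>"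
abbreviation "others i \<omega> \<equiv> interference kappa beta Y Em \<omega> + (interference kappa beta X Fm \<omega> - powerB i \<omega>)"

lemma random_variables [measurable]:
  "X i \<in> borel_measurable M" "Y i \<in> borel_measurable M"
  "Fm i \<in> borel_measurable M" "Em i \<in> borel_measurable M"
  using base_stations devices Fm_measurable Em_distr[of i]
  by (auto simp: homogeneous_PPP_def distributed_def)

lemma received_power_measurable [measurable]:
  "powerB i \<in> borel_measurable M" "powerD i \<in> borel_measurable M"
  unfolding received_power_def[abs_def] by measurable

lemma interference_measurable [measurable]:
  "interference kappa beta X Fm \<in> borel_measurable M"
  "interference kappa beta Y Em \<in> borel_measurable M"
  unfolding interference_def[abs_def] by measurable

lemma powers_laplace:
  assumes [measurable]: "u \<in> borel_measurable borel" "v \<in> borel_measurable borel"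
  shows "(\<integral>\<^sup>+\<omega>. eneg ((\<Sum>i. u (powerB i \<omega>)) + (\<Sum>j. v (powerD j \<omega>))) \<partial>M) =
    eneg ((\<integral>\<^sup>+p. 1 - eneg (u p) \<partial>intensityB) + (\<integral>\<^sup>+p. 1 - eneg (v p) \<partial>intensityD))"
  using joint_laplace[of "\<lambda>x m. u (ennreal m / ennreal (path_loss kappa beta x))"
      "\<lambda>x m. v (ennreal m / ennreal (path_loss kappa beta x))"] lamB lamD
  by (simp add: received_power_def nn_integral_power_intensity[OF lawF] nn_integral_power_intensity[OF lawE])

lemma total_laplace:
  "(\<integral>\<^sup>+\<omega>. eneg (s * total_power \<omega>) \<partial>M) =
    eneg ((\<integral>\<^sup>+p. 1 - eneg (s * p) \<partial>intensityB) + (\<integral>\<^sup>+p. 1 - eneg (s * p) \<partial>intensityD))"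
  using powers_laplace[of "\<lambda>p. s * p" "\<lambda>p. s * p"]
  by (simp add: interference_def distrib_left)

text \<open>Both sides are the negative derivative at t = 0 of the mean of exp (-s I - t S), where I
  is the total interference and S the sum of \<open>h\<close> over the base station powers. In the
  exponent, 1 - a b = (1 - a) + a (1 - b) separates the perturbation, which appears as an integral
  against the intensity tilted by \<open>eneg (s * p)\<close>.\<close>

lemma campbell_laplace:
  assumes h [measurable]: "h \<in> borel_measurable borel"
  shows "(\<integral>\<^sup>+\<omega>. (\<Sum>i. h (powerB i \<omega>)) * eneg (s * total_power \<omega>) \<partial>M) =
    (\<integral>\<^sup>+p. h p * eneg (s * p) \<partial>intensityB) * (\<integral>\<^sup>+\<omega>. eneg (s * total_power \<omega>) \<partial>M)"
proof -
  have [measurable_cong]: "sets intensityB = sets borel"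
    by (simp add: power_intensity_def)
  define S where "S \<omega> = (\<Sum>i. h (powerB i \<omega>))" for \<omega>
  define L where "L = (\<integral>\<^sup>+\<omega>. eneg (s * total_power \<omega>) \<partial>M)"
  \<comment> \<open>Scaled so that the perturbed functional is
    \<open>L * eneg (d k / 2 ^ k)\<close>; its difference quotient is then
    \<open>dq k (d k) * L\<close>.\<close>
  define d where "d k = (\<integral>\<^sup>+p. eneg (s * p) * dq k (h p) \<partial>intensityB)" for k
  have [measurable]: "S \<in> borel_measurable M"
    unfolding S_def by measurable
  have L: "L \<le> 1"
  proof -
    have "L \<le> (\<integral>\<^sup>+\<omega>. 1 \<partial>M)" unfolding L_def by (intro nn_integral_mono eneg_le_1)
    then show ?thesis by (simp add: emeasure_space_1)
  qed
  have two: "(2 :: ennreal) ^ k \<noteq> top" "(2 :: ennreal) ^ k \<noteq> 0" for k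
    by (auto simp: ennreal_two_power)
  have step: "(\<integral>\<^sup>+\<omega>. dq k (S \<omega>) * eneg (s * total_power \<omega>) \<partial>M) = dq k (d k) * L" for k
  proof -
    have split: "1 - eneg (s * p + h p / 2 ^ k) = (1 - eneg (s * p)) + eneg (s * p) * (1 - eneg (h p / 2 ^ k))" for p
      by (simp add: eneg_add ennreal_one_minus_mult eneg_le_1)
    have "(\<integral>\<^sup>+\<omega>. eneg (s * total_power \<omega> + S \<omega> / 2 ^ k) \<partial>M) =
        (\<integral>\<^sup>+\<omega>. eneg ((\<Sum>i. s * powerB i \<omega> + h (powerB i \<omega>) / 2 ^ k) + (\<Sum>j. s * powerD j \<omega>)) \<partial>M)"
      by (simp add: S_def interference_def distrib_left suminf_add[symmetric] divide_ennreal_def ac_simps)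
    also have "\<dots> = eneg ((\<integral>\<^sup>+p. 1 - eneg (s * p + h p / 2 ^ k) \<partial>intensityB) + (\<integral>\<^sup>+p. 1 - eneg (s * p) \<partial>intensityD))"
      by (rule powers_laplace) measurable
    also have "(\<integral>\<^sup>+p. 1 - eneg (s * p + h p / 2 ^ k) \<partial>intensityB) =
        (\<integral>\<^sup>+p. 1 - eneg (s * p) \<partial>intensityB) + (\<integral>\<^sup>+p. eneg (s * p) * (1 - eneg (h p / 2 ^ k)) \<partial>intensityB)"
      unfolding split by (rule nn_integral_add) measurable
    also have "(\<integral>\<^sup>+p. eneg (s * p) * (1 - eneg (h p / 2 ^ k)) \<partial>intensityB) = d k / 2 ^ k"
    proof -
      have "d k = (\<integral>\<^sup>+p. 2 ^ k * (eneg (s * p) * (1 - eneg (h p / 2 ^ k))) \<partial>intensityB)"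
        by (simp add: d_def dq_def ac_simps)
      also have "\<dots> = 2 ^ k * (\<integral>\<^sup>+p. eneg (s * p) * (1 - eneg (h p / 2 ^ k)) \<partial>intensityB)"
        by (rule nn_integral_cmult) measurable
      finally show ?thesis
        using two[of k] by (metis mult.commute mult_divide_eq_ennreal)
    qed
    finally have U: "(\<integral>\<^sup>+\<omega>. eneg (s * total_power \<omega> + S \<omega> / 2 ^ k) \<partial>M) = L * eneg (d k / 2 ^ k)"
      by (simp add: L_def total_laplace eneg_add ac_simps)
    have "(\<integral>\<^sup>+\<omega>. dq k (S \<omega>) * eneg (s * total_power \<omega>) \<partial>M) =
        (\<integral>\<^sup>+\<omega>. 2 ^ k * (eneg (s * total_power \<omega>) - eneg (s * total_power \<omega> + S \<omega> / 2 ^ k)) \<partial>M)"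
      by (simp add: dq_def eneg_add mult.assoc mult.commute[of "1 - _"] ennreal_right_diff_distrib)
    also have "\<dots> = 2 ^ k * (L - L * eneg (d k / 2 ^ k))"
    proof (subst nn_integral_cmult, measurable, subst nn_integral_diff)
      have "(\<integral>\<^sup>+\<omega>. eneg (s * total_power \<omega> + S \<omega> / 2 ^ k) \<partial>M) \<le> (\<integral>\<^sup>+\<omega>. 1 \<partial>M)"
        by (intro nn_integral_mono eneg_le_1)
      then show "(\<integral>\<^sup>+\<omega>. eneg (s * total_power \<omega> + S \<omega> / 2 ^ k) \<partial>M) \<noteq> \<infinity>"
        by (auto simp: emeasure_space_1 top_unique)
    qed (auto intro!: AE_I2 eneg_antimono simp: U L_def[symmetric])
    also have "\<dots> = dq k (d k) * L"
    proof -
      have "L \<noteq> top" using L by (auto simp: top_unique)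
      then have "L * (1 - eneg (d k / 2 ^ k)) = L - L * eneg (d k / 2 ^ k)"
        by (simp add: ennreal_right_diff_distrib)
      then show ?thesis by (metis dq_def mult.assoc mult.commute)
    qed
    finally show ?thesis .
  qed
  \<comment> \<open>The left side converges monotonically. On the right \<open>d k\<close> moves
    along with the index, hence the diagonal limit, and \<open>L \<le> 1\<close> keeps the factor
    finite.\<close>
  have "(\<lambda>k. \<integral>\<^sup>+\<omega>. dq k (S \<omega>) * eneg (s * total_power \<omega>) \<partial>M) \<longlonglongrightarrow> (\<integral>\<^sup>+\<omega>. S \<omega> * eneg (s * total_power \<omega>) \<partial>M)"
    by (rule nn_integral_LIMSEQ)
       (auto simp: incseq_def le_fun_def mult.commute[of _ "eneg _"]
         intro!: mult_left_mono incseqD[OF dq_incseq] ennreal_tendsto_cmult dq_tendsto)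
  moreover have "(\<lambda>k. dq k (d k) * L) \<longlonglongrightarrow> (\<integral>\<^sup>+p. h p * eneg (s * p) \<partial>intensityB) * L"
  proof -
    have "d \<longlonglongrightarrow> (\<integral>\<^sup>+p. h p * eneg (s * p) \<partial>intensityB)"
      unfolding d_def
      by (rule nn_integral_LIMSEQ)
         (auto simp: incseq_def le_fun_def mult.commute[of _ "eneg _"]
           intro!: mult_left_mono incseqD[OF dq_incseq] ennreal_tendsto_cmult dq_tendsto)
    moreover have "d k \<le> (\<integral>\<^sup>+p. h p * eneg (s * p) \<partial>intensityB)" for k
      unfolding d_def by (intro nn_integral_mono, subst mult.commute) (rule mult_right_mono[OF dq_le], simp)
    ultimately show ?thesis
      using le_less_trans[OF L ennreal_one_less_top] unfolding mult.commute[of _ L]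
      by (intro ennreal_tendsto_cmult dq_tendsto_diagonal) auto
  qed
  ultimately have "(\<integral>\<^sup>+\<omega>. S \<omega> * eneg (s * total_power \<omega>) \<partial>M) = (\<integral>\<^sup>+p. h p * eneg (s * p) \<partial>intensityB) * L"
    unfolding step by (rule LIMSEQ_unique)
  then show ?thesis
    by (simp add: S_def L_def)
qed

lemma powerB_le_interference: "powerB i \<omega> \<le> interference kappa beta X Fm \<omega>"
  using sum_le_suminf[of "\<lambda>i. powerB i \<omega>" "{i}"] by (simp add: interference_def)

text \<open>The weighted Campbell formula at \<open>s = n\<close>. An infinite own power could not
  be taken out of the total again, hence \<open>top \<notin> A\<close>. The case
  \<open>n = 0\<close> is the mean number of base stations received in \<open>A\<close>.\<close>

lemma mecke_moments:
  assumes A [measurable]: "A \<in> sets borel" and "top \<notin> A"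
  shows "(\<integral>\<^sup>+\<omega>. (\<Sum>i. indicator A (powerB i \<omega>) * eneg (others i \<omega>) ^ n) \<partial>M) =
    emeasure intensityB A * (\<integral>\<^sup>+\<omega>. eneg (total_power \<omega>) ^ n \<partial>M)"
proof -
  define h where "h p = indicator A p * ennreal (exp (real n * enn2real p))" for p :: ennreal
  have [measurable]: "h \<in> borel_measurable borel" unfolding h_def by measurable
  \<comment> \<open>The factor \<open>exp (n p)\<close> removes the own contribution of the point from \<open>exp (-n I)\<close>.\<close>
  have h: "h p * eneg (of_nat n * p) = indicator A p" for p
  proof (cases p)
    case (real r)
    then have "of_nat n * p = ennreal (real n * r)"
      by (simp add: ennreal_mult' ennreal_of_nat_eq_real_of_nat)
    with real show ?thesis
      by (simp add: h_def eneg_ennreal mult.assoc ennreal_mult'[symmetric] exp_minus)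
  next
    case top
    with \<open>top \<notin> A\<close> show ?thesis by (simp add: h_def)
  qed
  have "indicator A (powerB i \<omega>) * eneg (others i \<omega>) ^ n = h (powerB i \<omega>) * eneg (of_nat n * total_power \<omega>)" for i \<omega>
  proof -
    have "total_power \<omega> = powerB i \<omega> + others i \<omega>"
      using diff_add_cancel_ennreal[OF powerB_le_interference[of i \<omega>]] by (metis add.commute add.left_commute)
    then have "h (powerB i \<omega>) * eneg (of_nat n * total_power \<omega>) =
        (h (powerB i \<omega>) * eneg (of_nat n * powerB i \<omega>)) * eneg (of_nat n * others i \<omega>)"
      by (simp only: distrib_left eneg_add mult.assoc)
    then show ?thesis
      unfolding h by (simp add: eneg_of_nat_mult)
  qed
  then have "(\<integral>\<^sup>+\<omega>. (\<Sum>i. indicator A (powerB i \<omega>) * eneg (others i \<omega>) ^ n) \<partial>M) =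
      (\<integral>\<^sup>+\<omega>. (\<Sum>i. h (powerB i \<omega>)) * eneg (of_nat n * total_power \<omega>) \<partial>M)"
    by simp
  also have "\<dots> = (\<integral>\<^sup>+p. h p * eneg (of_nat n * p) \<partial>intensityB) * (\<integral>\<^sup>+\<omega>. eneg (of_nat n * total_power \<omega>) \<partial>M)"
    by (rule campbell_laplace) measurable
  also have "(\<integral>\<^sup>+p. h p * eneg (of_nat n * p) \<partial>intensityB) = emeasure intensityB A"
    unfolding h by (simp add: power_intensity_def)
  finally show ?thesis
    by (simp add: eneg_of_nat_mult)
qed

end

text \<open>A sum over base stations becomes one integral over index and outcome. The powers of all
  base stations, paired with the interference they face, thus have an image measure, to which
  uniqueness and monotone convergence apply.\<close>

lemma (in sigma_finite_measure) nn_integral_count_space_pair: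
  assumes [measurable]: "\<And>i. f i \<in> borel_measurable M"
  shows "(\<integral>\<^sup>+(i, \<omega>). f i \<omega> \<partial>(count_space (UNIV :: nat set) \<Otimes>\<^sub>M M)) = (\<integral>\<^sup>+\<omega>. (\<Sum>i. f i \<omega>) \<partial>M)"
proof -
  have "(\<integral>\<^sup>+(i, \<omega>). f i \<omega> \<partial>(count_space (UNIV :: nat set) \<Otimes>\<^sub>M M)) =
      (\<integral>\<^sup>+i. \<integral>\<^sup>+\<omega>. f i \<omega> \<partial>M \<partial>count_space (UNIV :: nat set))"
    by (subst nn_integral_fst[symmetric]) (auto intro!: measurable_pair_measure_countable1)
  also have "\<dots> = (\<Sum>i. \<integral>\<^sup>+\<omega>. f i \<omega> \<partial>M)"
    by (rule nn_integral_count_space_nat)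
  also have "\<dots> = (\<integral>\<^sup>+\<omega>. (\<Sum>i. f i \<omega>) \<partial>M)"
    by (rule nn_integral_suminf[symmetric]) measurable
  finally show ?thesis .
qed

text \<open>The coordinate \<open>exp (-x)\<close> compactifies \<open>[0, \<infinity>]\<close> to \<open>[0, 1]\<close>, where moments determine a measure.\<close>

definition laplace_coord :: "ennreal \<Rightarrow> real" where
  "laplace_coord x = enn2real (eneg x)"

lemma laplace_coord_measurable [measurable]: "laplace_coord \<in> borel_measurable borel"
  unfolding laplace_coord_def[abs_def] by measurable

lemma ennreal_laplace_coord: "ennreal (laplace_coord x) = eneg x"
  by (simp add: laplace_coord_def)

lemma laplace_coord_bounds: "laplace_coord x \<in> {0..1}"
  using eneg_le_1[of x] by (auto simp: laplace_coord_def enn2real_leI)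

lemma laplace_coord_power: "ennreal (laplace_coord x ^ n) = eneg x ^ n"
  using laplace_coord_bounds[of x] by (simp add: ennreal_power[symmetric] ennreal_laplace_coord)

context positive_network begin

text \<open>The measure \<open>\<nu>\<close> counts base stations received in \<open>A\<close> by
  the coordinate of the interference they face; \<open>\<rho>\<close> is the law of the coordinate
  of the total interference, scaled by the intensity of \<open>A\<close>. Both live on [0, 1] and
  have the same moments.\<close>

lemma mecke_rectangle:
  assumes A [measurable]: "A \<in> sets borel" and "top \<notin> A" and fin: "emeasure intensityB A < top"
    and B [measurable]: "B \<in> sets borel"
  shows "(\<integral>\<^sup>+\<omega>. (\<Sum>i. indicator A (powerB i \<omega>) * indicator B (laplace_coord (others i \<omega>))) \<partial>M) =
    emeasure intensityB A * emeasure (distr M borel (\<lambda>\<omega>. laplace_coord (total_power \<omega>))) B"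
proof -
  define C where "C = count_space (UNIV :: nat set) \<Otimes>\<^sub>M M"
  define \<nu> where "\<nu> = distr (density C (\<lambda>(i, \<omega>). indicator A (powerB i \<omega>))) borel
      (\<lambda>(i, \<omega>). laplace_coord (others i \<omega>))"
  define \<rho> where "\<rho> = density (distr M borel (\<lambda>\<omega>. laplace_coord (total_power \<omega>))) (\<lambda>_. emeasure intensityB A)"
  have C_meas: "(\<lambda>(i, \<omega>). f i \<omega>) \<in> measurable C N" if "\<And>i. f i \<in> measurable M N" for f and N :: "'z measure"
    unfolding C_def using that by (intro measurable_pair_measure_countable1) auto
  have [measurable]: "(\<lambda>(i, \<omega>). indicator A (powerB i \<omega>) :: ennreal) \<in> borel_measurable C"
      "(\<lambda>(i, \<omega>). laplace_coord (others i \<omega>)) \<in> borel_measurable C"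
    by (rule C_meas; measurable)+
  have \<nu>: "(\<integral>\<^sup>+z. f z \<partial>\<nu>) = (\<integral>\<^sup>+\<omega>. (\<Sum>i. indicator A (powerB i \<omega>) * f (laplace_coord (others i \<omega>))) \<partial>M)"
    if [measurable]: "f \<in> borel_measurable borel" for f
    unfolding \<nu>_def
    by (subst nn_integral_distr, measurable, subst nn_integral_density)
       (auto simp: C_def nn_integral_count_space_pair[symmetric] case_prod_unfold
         intro!: C_meas[unfolded C_def case_prod_unfold] nn_integral_cong)
  have \<rho>: "(\<integral>\<^sup>+z. f z \<partial>\<rho>) = emeasure intensityB A * (\<integral>\<^sup>+\<omega>. f (laplace_coord (total_power \<omega>)) \<partial>M)"
    if [measurable]: "f \<in> borel_measurable borel" for f
    unfolding \<rho>_def by (simp add: nn_integral_density nn_integral_cmult nn_integral_distr)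
  have moments: "(\<integral>\<^sup>+x. ennreal (x ^ n) \<partial>\<nu>) = (\<integral>\<^sup>+x. ennreal (x ^ n) \<partial>\<rho>)" for n
    using mecke_moments[OF A \<open>top \<notin> A\<close>, of n] by (simp add: \<nu> \<rho> laplace_coord_power)
  have "\<nu> = \<rho>"
  proof (rule moments_determine_measure)
    \<comment> \<open>The moment of order 0 is the total mass, so the finite intensity of
      \<open>A\<close> makes both measures finite.\<close>
    have mass: "emeasure N (space N) = emeasure intensityB A" if "N = \<nu> \<or> N = \<rho>" for N
    proof -
      have "emeasure N (space N) = (\<integral>\<^sup>+x. ennreal (x ^ 0) \<partial>N)" by simp
      also have "\<dots> = (\<integral>\<^sup>+x. ennreal (x ^ 0) \<partial>\<rho>)" using that moments[of 0] by auto
      also have "\<dots> = emeasure intensityB A" by (subst \<rho>) (simp_all add: emeasure_space_1)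
      finally show ?thesis .
    qed
    then show "finite_measure \<nu>" "finite_measure \<rho>"
      using fin by (auto intro!: finite_measureI)
    show "AE x in \<nu>. x \<in> {0..1}"
      unfolding \<nu>_def
      by (subst AE_distr_iff)
         (auto split: prod.splits simp: laplace_coord_bounds simp del: atLeastAtMost_iff intro!: AE_I2)
    have "AE x in distr M borel (\<lambda>\<omega>. laplace_coord (total_power \<omega>)). x \<in> {0..1}"
      by (subst AE_distr_iff) (use laplace_coord_bounds in \<open>auto simp del: atLeastAtMost_iff\<close>)
    then show "AE x in \<rho>. x \<in> {0..1}"
      unfolding \<rho>_def by (subst AE_density) (auto elim!: eventually_mono simp del: atLeastAtMost_iff)
  qed (rule moments | simp add: \<nu>_def \<rho>_def)+
  then have "(\<integral>\<^sup>+z. indicator B z \<partial>\<nu>) = (\<integral>\<^sup>+z. indicator B z \<partial>\<rho>)" by simp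
  moreover have "(\<integral>\<^sup>+\<omega>. indicator B (laplace_coord (total_power \<omega>)) \<partial>M) =
      emeasure (distr M borel (\<lambda>\<omega>. laplace_coord (total_power \<omega>))) B"
    by (subst nn_integral_indicator[symmetric]) (simp_all add: nn_integral_distr del: nn_integral_indicator)
  ultimately show ?thesis
    by (simp add: \<nu> \<rho> del: nn_integral_indicator)
qed

end

text \<open>A positive sequence decreasing to 0; positivity keeps the intensity beyond each level
  finite.\<close>

definition cutoff :: "nat \<Rightarrow> ennreal" where
  "cutoff n = ennreal (1 / real (Suc n))"

lemma indicator_cutoff_tendsto:
  "(\<lambda>n. indicator {cutoff n<..<top} p :: ennreal) \<longlonglongrightarrow> indicator {0<..<top} p"
proof (cases "0 < p")
  case True
  have "(\<lambda>n. 1 / real (Suc n)) \<longlonglongrightarrow> 0"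
    by real_asymp
  then have "cutoff \<longlonglongrightarrow> 0"
    unfolding cutoff_def[abs_def] using tendsto_ennrealI by fastforce
  then have "eventually (\<lambda>n. cutoff n < p) sequentially"
    using True by (rule order_tendstoD)
  then show ?thesis
    by (intro tendsto_eventually) (auto elim!: eventually_mono simp: indicator_def True)
qed (auto simp: indicator_def)

lemma indicator_cutoff_mono:
  assumes "m \<le> n"
  shows "indicator {cutoff m<..<top} p \<le> (indicator {cutoff n<..<top} p :: ennreal)"
proof -
  have "cutoff n \<le> cutoff m"
    unfolding cutoff_def using assms by (intro ennreal_leI frac_le) auto
  then show ?thesis
    by (auto simp: indicator_def intro: le_less_trans)
qed

section \<open>Mecke formula for general functions and the mean number of exceedances\<close>

context positive_network begin

lemma intensityB_power_law: "power_law intensityB (propagation_const_BS M kappa beta lamB F) (2 / beta)"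
proof -
  have [measurable]: "F \<in> borel_measurable M" by (rule F_measurable)
  have "(\<integral>\<^sup>+m. ennreal (m powr (2 / beta)) \<partial>lawF) = ennreal (\<integral>\<omega>. F \<omega> powr (2 / beta) \<partial>M)"
    using F_moment_finite by (simp add: nn_integral_distr nn_integral_eq_integral)
  moreover have "AE m in lawF. 0 < m"
    using F_positive by (simp add: AE_distr_iff)
  ultimately show ?thesis
    using kappa beta lamB F_moment_positive unfolding propagation_const_BS_def
    by (intro power_intensity_power_law lawF) auto
qed

text \<open>The moment of order \<open>2 / beta\<close> of the exponential law is a Gamma integral,
  the origin of \<open>Gamma (1 + 2 / beta)\<close> in the constant of the devices.\<close>

lemma intensityD_power_law: "power_law intensityD (propagation_const_Dev kappa beta lamD) (2 / beta)"
proof -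
  have "(\<integral>\<^sup>+m. ennreal (m powr (2 / beta)) \<partial>lawE) =
      (\<integral>\<^sup>+m. ennreal (exponential_density 1 m) * ennreal (m powr (2 / beta)) \<partial>lborel)"
    by (rule nn_integral_density) auto
  also have "\<dots> = (\<integral>\<^sup>+m. ennreal (m powr ((1 + 2 / beta) - 1) * exp (- (1 * m))) * indicator {0<..} m \<partial>lborel)"
    by (intro nn_integral_cong)
       (auto simp: exponential_density_def indicator_def ennreal_mult'[symmetric] mult.commute)
  also have "\<dots> = ennreal (Gamma (1 + 2 / beta))"
    using beta by (subst nn_integral_Gamma_scaled) (auto simp: add_pos_pos)
  finally have "(\<integral>\<^sup>+m. ennreal (m powr (2 / beta)) \<partial>lawE) = ennreal (Gamma (1 + 2 / beta))" .
  moreover have "AE m in lawE. 0 < m"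
  proof -
    have "AE m in lborel. 0 < ennreal (exponential_density 1 m) \<longrightarrow> 0 < m"
      using AE_lborel_singleton[of 0]
      by eventually_elim (auto simp: exponential_density_def split: if_splits)
    then show ?thesis by (simp add: AE_density)
  qed
  ultimately show ?thesis
    using kappa beta lamD unfolding propagation_const_Dev_def
    by (intro power_intensity_power_law lawE) (auto intro!: less_imp_le[OF Gamma_real_pos] simp: add_pos_pos)
qed

lemma propagation_consts_pos:
  "0 < propagation_const_BS M kappa beta lamB F" "0 < propagation_const_Dev kappa beta lamD"
  using kappa beta lamB lamD F_moment_positive
  by (auto simp: propagation_const_BS_def propagation_const_Dev_def add_pos_pos intro!: mult_pos_pos divide_pos_pos)

text \<open>A product of finite measures is determined by its rectangles, so the rectangle identity
  extends to all measurable \<open>f\<close>. The lower cut \<open>e\<close> makes the intensity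
  finite.\<close>

lemma mecke_formula:
  assumes f [measurable]: "f \<in> borel_measurable (borel \<Otimes>\<^sub>M borel)" and "0 < e"
  shows "(\<integral>\<^sup>+\<omega>. (\<Sum>i. indicator {ennreal e<..<top} (powerB i \<omega>) * f (powerB i \<omega>, others i \<omega>)) \<partial>M) =
    (\<integral>\<^sup>+\<omega>. \<integral>\<^sup>+p. indicator {ennreal e<..<top} p * f (p, total_power \<omega>) \<partial>intensityB \<partial>M)"
proof -
  note law = intensityB_power_law
  have [measurable_cong]: "sets intensityB = sets borel" using law by (rule power_lawD)
  let ?A = "{ennreal e<..<top}"
  have A_fin: "emeasure intensityB B < top" if "B \<in> sets borel" "B \<subseteq> ?A" for B
  proof -
    have "emeasure intensityB B \<le> emeasure intensityB {ennreal e<..}"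
      using that by (intro emeasure_mono) (auto simp: power_lawD(1)[OF law])
    also have "\<dots> < top"
      by (simp add: power_lawD(3)[OF law \<open>0 < e\<close>])
    finally show ?thesis .
  qed
  define C where "C = count_space (UNIV :: nat set) \<Otimes>\<^sub>M M"
  define \<mu> where "\<mu> = density intensityB (indicator ?A)"
  have [measurable_cong]: "sets \<mu> = sets borel"
    by (simp add: \<mu>_def power_lawD(1)[OF law])
  define Z where "Z = distr M borel (\<lambda>\<omega>. laplace_coord (total_power \<omega>))"
  define \<nu> where "\<nu> = distr (density C (\<lambda>(i, \<omega>). indicator ?A (powerB i \<omega>))) (borel \<Otimes>\<^sub>M borel)
      (\<lambda>(i, \<omega>). (powerB i \<omega>, laplace_coord (others i \<omega>)))"
  \<comment> \<open>The rectangle identity concerns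
    \<open>laplace_coord (others i \<omega>)\<close>; this is \<open>f\<close> expressed in that
    coordinate.\<close>
  define g where "g = (\<lambda>(p, z). f (p, eneg_inv (ennreal z)))"
  have [measurable]: "g \<in> borel_measurable (borel \<Otimes>\<^sub>M borel)"
    unfolding g_def by measurable
  have g: "g (p, laplace_coord x) = f (p, x)" for p x
    by (simp add: g_def ennreal_laplace_coord eneg_inv_eneg)
  have C_meas: "(\<lambda>(i, \<omega>). k i \<omega>) \<in> measurable C N" if "\<And>i. k i \<in> measurable M N" for k and N :: "'z measure"
    unfolding C_def using that by (intro measurable_pair_measure_countable1) auto
  have [measurable]: "(\<lambda>(i, \<omega>). indicator ?A (powerB i \<omega>) :: ennreal) \<in> borel_measurable C"
      "(\<lambda>(i, \<omega>). (powerB i \<omega>, laplace_coord (others i \<omega>))) \<in> measurable C (borel \<Otimes>\<^sub>M borel)"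
    by (rule C_meas; measurable)+
  have \<nu>: "(\<integral>\<^sup>+z. k z \<partial>\<nu>) =
      (\<integral>\<^sup>+\<omega>. (\<Sum>i. indicator ?A (powerB i \<omega>) * k (powerB i \<omega>, laplace_coord (others i \<omega>))) \<partial>M)"
    if [measurable]: "k \<in> borel_measurable (borel \<Otimes>\<^sub>M borel)" for k
    unfolding \<nu>_def
    by (subst nn_integral_distr, measurable, subst nn_integral_density)
       (auto simp: C_def nn_integral_count_space_pair[symmetric] case_prod_unfold
         intro!: C_meas[unfolded C_def case_prod_unfold] nn_integral_cong)
  interpret \<mu>: finite_measure \<mu>
  proof (rule finite_measureI)
    show "emeasure \<mu> (space \<mu>) \<noteq> \<infinity>"
      using A_fin[of ?A] by (auto simp: \<mu>_def emeasure_density sets_eq_imp_space_eq[OF power_lawD(1)[OF law]])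
  qed
  interpret Z: prob_space Z
    unfolding Z_def by (rule prob_space_distr) measurable
  interpret pair_sigma_finite \<mu> Z ..
  have prod: "\<mu> \<Otimes>\<^sub>M Z = \<nu>"
  proof (rule pair_measure_eqI)
    show "sets (\<mu> \<Otimes>\<^sub>M Z) = sets \<nu>"
      by (simp add: \<mu>_def Z_def \<nu>_def power_lawD(1)[OF law] cong: sets_pair_measure_cong)
    fix A B assume "A \<in> sets \<mu>" "B \<in> sets Z"
    then have [measurable]: "A \<in> sets borel" "B \<in> sets borel"
      by (auto simp: \<mu>_def Z_def power_lawD(1)[OF law])
    have "emeasure \<nu> (A \<times> B) = (\<integral>\<^sup>+z. indicator (A \<times> B) z \<partial>\<nu>)"
      by (rule nn_integral_indicator[symmetric]) (simp add: \<nu>_def)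
    also have "\<dots> = (\<integral>\<^sup>+\<omega>. (\<Sum>i. indicator (A \<inter> ?A) (powerB i \<omega>) * indicator B (laplace_coord (others i \<omega>))) \<partial>M)"
      by (subst \<nu>) (auto simp: indicator_def intro!: nn_integral_cong suminf_cong)
    also have "\<dots> = emeasure intensityB (A \<inter> ?A) * emeasure Z B"
      unfolding Z_def by (intro mecke_rectangle A_fin) auto
    also have "emeasure intensityB (A \<inter> ?A) = (\<integral>\<^sup>+p. indicator (A \<inter> ?A) p \<partial>intensityB)"
      by (rule nn_integral_indicator[symmetric]) simp
    also have "\<dots> = (\<integral>\<^sup>+p. indicator ?A p * indicator A p \<partial>intensityB)"
      by (intro nn_integral_cong) (auto simp: indicator_def)
    also have "\<dots> = emeasure \<mu> A"
      unfolding \<mu>_def by (rule emeasure_density[symmetric]) auto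
    finally show "emeasure \<mu> A * emeasure Z B = emeasure \<nu> (A \<times> B)" by simp
  qed (auto intro: \<mu>.sigma_finite_measure_axioms Z.sigma_finite_measure_axioms)
  have "(\<integral>\<^sup>+\<omega>. (\<Sum>i. indicator ?A (powerB i \<omega>) * f (powerB i \<omega>, others i \<omega>)) \<partial>M) = (\<integral>\<^sup>+z. g z \<partial>\<nu>)"
    by (simp add: \<nu> g)
  also have "\<dots> = (\<integral>\<^sup>+z. \<integral>\<^sup>+p. g (p, z) \<partial>\<mu> \<partial>Z)"
    unfolding prod[symmetric]
    by (rule nn_integral_snd[symmetric]) (simp add: \<mu>_def Z_def power_lawD(1)[OF law] cong: measurable_cong_sets sets_pair_measure_cong)
  also have "\<dots> = (\<integral>\<^sup>+\<omega>. \<integral>\<^sup>+p. f (p, total_power \<omega>) \<partial>\<mu> \<partial>M)"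
    unfolding Z_def by (subst nn_integral_distr) (auto simp: g)
  also have "\<dots> = (\<integral>\<^sup>+\<omega>. \<integral>\<^sup>+p. indicator ?A p * f (p, total_power \<omega>) \<partial>intensityB \<partial>M)"
    unfolding \<mu>_def by (intro nn_integral_cong nn_integral_density) auto
  finally show ?thesis .
qed

text \<open>The Mecke formula for the indicator of \<open>ennreal t * x < p\<close>, with the lower
  cut sent to 0 by monotone convergence on both sides. Power 0 is excluded by the strict inequality
  itself; only the cut at \<open>top\<close> needs an argument.\<close>

lemma expected_exceedances:
  assumes "0 < t"
  shows "(\<integral>\<^sup>+\<omega>. (\<Sum>i. indicator {x. ennreal t * others i \<omega> < x} (powerB i \<omega>)) \<partial>M) =
    (\<integral>\<^sup>+\<omega>. emeasure intensityB {ennreal t * total_power \<omega><..} \<partial>M)"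
proof -
  note law = intensityB_power_law
  have [measurable_cong]: "sets intensityB = sets borel" using law by (rule power_lawD)
  interpret B: sigma_finite_measure intensityB using law by (rule power_law_sigma_finite)
  define f :: "ennreal \<times> ennreal \<Rightarrow> ennreal" where "f = (\<lambda>(p, x). if ennreal t * x < p then 1 else 0)"
  have [measurable]: "f \<in> borel_measurable (borel \<Otimes>\<^sub>M borel)" unfolding f_def by measurable
  define C where "C = count_space (UNIV :: nat set) \<Otimes>\<^sub>M M"
  have C_meas: "(\<lambda>(i, \<omega>). k i \<omega>) \<in> measurable C N" if "\<And>i. k i \<in> measurable M N" for k and N :: "'z measure"
    unfolding C_def using that by (intro measurable_pair_measure_countable1) auto
  let ?e = "\<lambda>n. {cutoff n<..<top}"
  have lim1: "(\<lambda>n. \<integral>\<^sup>+\<omega>. (\<Sum>i. indicator (?e n) (powerB i \<omega>) * f (powerB i \<omega>, others i \<omega>)) \<partial>M) \<longlonglongrightarrow>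
      (\<integral>\<^sup>+\<omega>. (\<Sum>i. indicator {x. ennreal t * others i \<omega> < x} (powerB i \<omega>)) \<partial>M)"
  proof -
    have "(\<lambda>n. \<integral>\<^sup>+(i, \<omega>). indicator (?e n) (powerB i \<omega>) * f (powerB i \<omega>, others i \<omega>) \<partial>C) \<longlonglongrightarrow>
       (\<integral>\<^sup>+(i, \<omega>). indicator {0<..<top} (powerB i \<omega>) * f (powerB i \<omega>, others i \<omega>) \<partial>C)"
    proof (rule nn_integral_LIMSEQ)
      show "incseq (\<lambda>n (i, \<omega>). indicator (?e n) (powerB i \<omega>) * f (powerB i \<omega>, others i \<omega>))"
        by (auto simp: incseq_def le_fun_def intro!: mult_right_mono indicator_cutoff_mono)
      show "(\<lambda>n. case z of (i, \<omega>) \<Rightarrow> indicator (?e n) (powerB i \<omega>) * f (powerB i \<omega>, others i \<omega>)) \<longlonglongrightarrow>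
          (case z of (i, \<omega>) \<Rightarrow> indicator {0<..<top} (powerB i \<omega>) * f (powerB i \<omega>, others i \<omega>))" for z
        by (cases z) (auto simp: f_def intro: indicator_cutoff_tendsto)
    qed (rule C_meas, measurable)
    also have "(\<integral>\<^sup>+(i, \<omega>). indicator {0<..<top} (powerB i \<omega>) * f (powerB i \<omega>, others i \<omega>) \<partial>C) =
        (\<integral>\<^sup>+\<omega>. (\<Sum>i. indicator {0<..<top} (powerB i \<omega>) * f (powerB i \<omega>, others i \<omega>)) \<partial>M)"
      unfolding C_def by (rule nn_integral_count_space_pair) measurable
    also have "\<dots> = (\<integral>\<^sup>+\<omega>. (\<Sum>i. indicator {x. ennreal t * others i \<omega> < x} (powerB i \<omega>)) \<partial>M)"
    proof (intro nn_integral_cong suminf_cong)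
      fix i \<omega>
      \<comment> \<open>In \<open>ennreal\<close>, \<open>top - top\<close> is \<open>top\<close>: a
        base station of infinite power faces infinite interference and never exceeds the threshold,
        so the cut loses nothing.\<close>
      have "others i \<omega> = top" if "powerB i \<omega> = top"
        using powerB_le_interference[of i \<omega>] that by (simp add: top_unique)
      then show "indicator {0<..<top} (powerB i \<omega>) * f (powerB i \<omega>, others i \<omega>) =
          indicator {x. ennreal t * others i \<omega> < x} (powerB i \<omega>)"
        using assms by (cases "powerB i \<omega> = top")
          (auto simp: f_def indicator_def ennreal_mult_top less_top[symmetric] intro: le_less_trans[OF zero_le])
    qed
    finally show ?thesis
      unfolding C_def by (subst (asm) nn_integral_count_space_pair) measurable
  qed
  have lim2: "(\<lambda>n. \<integral>\<^sup>+\<omega>. \<integral>\<^sup>+p. indicator (?e n) p * f (p, total_power \<omega>) \<partial>intensityB \<partial>M) \<longlonglongrightarrow>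
      (\<integral>\<^sup>+\<omega>. emeasure intensityB {ennreal t * total_power \<omega><..} \<partial>M)"
  proof (rule nn_integral_LIMSEQ)
    show "incseq (\<lambda>n \<omega>. \<integral>\<^sup>+p. indicator (?e n) p * f (p, total_power \<omega>) \<partial>intensityB)"
      by (auto simp: incseq_def le_fun_def intro!: nn_integral_mono mult_right_mono indicator_cutoff_mono)
    fix \<omega>
    have "(\<lambda>n. \<integral>\<^sup>+p. indicator (?e n) p * f (p, total_power \<omega>) \<partial>intensityB) \<longlonglongrightarrow>
        (\<integral>\<^sup>+p. indicator {0<..<top} p * f (p, total_power \<omega>) \<partial>intensityB)"
    proof (rule nn_integral_LIMSEQ)
      show "incseq (\<lambda>n p. indicator (?e n) p * f (p, total_power \<omega>))"
        by (auto simp: incseq_def le_fun_def intro!: mult_right_mono indicator_cutoff_mono)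
      show "(\<lambda>n. indicator (?e n) p * f (p, total_power \<omega>)) \<longlonglongrightarrow> indicator {0<..<top} p * f (p, total_power \<omega>)" for p
        by (auto simp: f_def intro: indicator_cutoff_tendsto)
    qed measurable
    also have "(\<integral>\<^sup>+p. indicator {0<..<top} p * f (p, total_power \<omega>) \<partial>intensityB) =
        (\<integral>\<^sup>+p. indicator {ennreal t * total_power \<omega><..} p \<partial>intensityB)"
    proof (rule nn_integral_cong_AE)
      have "AE p in intensityB. p \<noteq> top"
        using power_law_top[OF law] beta power_lawD(1)[OF law]
        by (intro AE_I[of _ _ "{top}"]) auto
      then show "AE p in intensityB. indicator {0<..<top} p * f (p, total_power \<omega>) = indicator {ennreal t * total_power \<omega><..} p"
        by eventually_elim (auto simp: f_def indicator_def less_top[symmetric] intro: le_less_trans[OF zero_le])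
    qed
    finally show "(\<lambda>n. \<integral>\<^sup>+p. indicator (?e n) p * f (p, total_power \<omega>) \<partial>intensityB) \<longlonglongrightarrow>
        emeasure intensityB {ennreal t * total_power \<omega><..}"
      by simp
  qed measurable
  show ?thesis
    using lim1 lim2 unfolding cutoff_def by (simp add: mecke_formula LIMSEQ_unique del: of_nat_Suc)
qed

end

section \<open>Connection probability\<close>

text \<open>For positive \<open>t\<close> the conventions of \<open>ennreal\<close> fit in the
  degenerate cases: a positive power divided by 0 is \<open>top\<close>, 0 divided by 0 is 0, and
  anything divided by \<open>top\<close> is 0.\<close>

lemma ennreal_less_divide_iff:
  fixes p x :: ennreal
  assumes "0 < t"
  shows "ennreal t < p / x \<longleftrightarrow> ennreal t * x < p"
proof (cases x)
  case (real r)
  show ?thesis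
  proof (cases "r = 0")
    case True
    then show ?thesis using real by (cases "p = 0") (auto simp: gr_zeroI)
  next
    case False
    with real have r: "0 < r" by simp
    show ?thesis
    proof (cases p)
      case (real q)
      then show ?thesis
        using r assms \<open>x = ennreal r\<close>
        by (simp add: divide_ennreal ennreal_less_iff ennreal_mult'[symmetric] field_simps)
    next
      case top
      then show ?thesis
        using r assms \<open>x = ennreal r\<close> by (simp add: ennreal_top_divide ennreal_mult'[symmetric])
    qed
  qed
next
  case top
  then show ?thesis using assms by (simp add: ennreal_mult_top)
qed

lemma ennreal_le_diff:
  fixes a b c :: ennreal
  assumes "a + b \<le> c"
  shows "b \<le> c - a"
proof (cases "a = top")
  case True
  with assms show ?thesis by (simp add: top_unique)
next
  case False
  then have "b = (a + b) - a" by simp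
  also have "\<dots> \<le> c - a" using assms by (rule ennreal_minus_mono) simp
  finally show ?thesis .
qed

context positive_network begin

abbreviation "\<alpha> \<equiv> 2 / beta"
abbreviation "aB \<equiv> propagation_const_BS M kappa beta lamB F"
abbreviation "aD \<equiv> propagation_const_Dev kappa beta lamD"

lemma alpha: "0 < \<alpha>" "\<alpha> < 1"
  using beta by auto

lemma total_power_stable:
  assumes "0 < s"
  shows "(\<integral>\<^sup>+\<omega>. eneg (ennreal s * total_power \<omega>) \<partial>M) =
    ennreal (exp (- ((aB + aD) * Gamma (1 - \<alpha>) * s powr \<alpha>)))"
proof -
  have G: "0 < Gamma (1 - \<alpha>)" using alpha by (intro Gamma_real_pos) auto
  have "(\<integral>\<^sup>+\<omega>. eneg (ennreal s * total_power \<omega>) \<partial>M) =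
      eneg (ennreal (aB * Gamma (1 - \<alpha>) * s powr \<alpha>) + ennreal (aD * Gamma (1 - \<alpha>) * s powr \<alpha>))"
    unfolding total_laplace
    by (simp only: power_law_laplace[OF intensityB_power_law propagation_consts_pos(1) alpha assms]
        power_law_laplace[OF intensityD_power_law propagation_consts_pos(2) alpha assms])
  also have "\<dots> = eneg (ennreal ((aB + aD) * Gamma (1 - \<alpha>) * s powr \<alpha>))"
    using propagation_consts_pos G by (subst ennreal_plus[symmetric]) (auto simp: algebra_simps)
  also have "\<dots> = ennreal (exp (- ((aB + aD) * Gamma (1 - \<alpha>) * s powr \<alpha>)))"
    using propagation_consts_pos G by (intro eneg_ennreal) auto
  finally show ?thesis .
qed

text \<open>Where the interference vanishes, \<open>eneg (s * I)\<close> equals 1 for every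
  \<open>s\<close>. The probability of this event is thus at most the Laplace transform at
  \<open>s\<close>, which tends to 0 as \<open>s\<close> grows. The Gamma integral for a negative
  power is applied off this event.\<close>

lemma total_power_nonzero: "AE \<omega> in M. total_power \<omega> \<noteq> 0"
proof -
  define c where "c = (aB + aD) * Gamma (1 - \<alpha>)"
  have "0 < Gamma (1 - \<alpha>)" using alpha by (intro Gamma_real_pos) auto
  then have c: "0 < c" using propagation_consts_pos by (simp add: c_def)
  let ?N = "{\<omega> \<in> space M. total_power \<omega> = 0}"
  have bound: "emeasure M ?N \<le> ennreal (exp (- (c * real (Suc n) powr \<alpha>)))" for n
  proof -
    have "emeasure M ?N = (\<integral>\<^sup>+\<omega>. indicator ?N \<omega> \<partial>M)" by simp
    also have "\<dots> \<le> (\<integral>\<^sup>+\<omega>. eneg (ennreal (real (Suc n)) * total_power \<omega>) \<partial>M)"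
      by (intro nn_integral_mono) (auto simp: indicator_def)
    finally show ?thesis
      by (subst (asm) total_power_stable) (auto simp: c_def)
  qed
  have "(\<lambda>n. exp (- (c * real (Suc n) powr \<alpha>))) \<longlonglongrightarrow> 0"
    using c alpha by real_asymp
  then have "(\<lambda>n. ennreal (exp (- (c * real (Suc n) powr \<alpha>)))) \<longlonglongrightarrow> ennreal 0"
    by (rule tendsto_ennrealI)
  then have "emeasure M ?N \<le> ennreal 0"
    using bound by (intro LIMSEQ_le_const[where a = "emeasure M ?N"]) auto
  then show ?thesis
    by (intro AE_I[of _ _ ?N]) auto
qed

lemma exceedance_integral:
  assumes "0 < t"
  shows "(\<integral>\<^sup>+\<omega>. emeasure intensityB {ennreal t * total_power \<omega><..} \<partial>M) =
    ennreal (t powr (- \<alpha>) / (Gamma (1 + \<alpha>) * Gamma (1 - \<alpha>)) * (aB / (aB + aD)))"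
proof -
  define c where "c = (aB + aD) * Gamma (1 - \<alpha>)"
  \<comment> \<open>Combines the factor \<open>aB * t powr (- \<alpha>)\<close> of the tail with the
    \<open>1 / Gamma \<alpha>\<close> from writing \<open>r powr (- \<alpha>)\<close> as a Gamma
    integral.\<close>
  define C where "C = aB * t powr (- \<alpha>) / Gamma \<alpha>"
  have G: "0 < Gamma (1 - \<alpha>)" "0 < Gamma \<alpha>" using alpha by (auto intro!: Gamma_real_pos)
  then have c: "0 < c" using propagation_consts_pos by (simp add: c_def)
  have C: "0 \<le> C" using G propagation_consts_pos by (simp add: C_def)
  have tail: "emeasure intensityB {ennreal t * x<..} =
      ennreal C * (\<integral>\<^sup>+s. ennreal (s powr (\<alpha> - 1)) * eneg (ennreal s * x) * indicator {0<..} s \<partial>lborel)"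
    if "x \<noteq> 0" for x
  proof (cases x)
    case (real r)
    with that have r: "0 < r" by auto
    have "(\<integral>\<^sup>+s. ennreal (s powr (\<alpha> - 1)) * eneg (ennreal s * x) * indicator {0<..} s \<partial>lborel) =
        (\<integral>\<^sup>+s. ennreal (s powr (\<alpha> - 1) * exp (- (r * s))) * indicator {0<..} s \<partial>lborel)"
      using real r by (intro nn_integral_cong)
        (auto simp: indicator_def eneg_ennreal ennreal_mult'[symmetric] mult.commute)
    also have "\<dots> = ennreal (Gamma \<alpha> * r powr (- \<alpha>))"
      using alpha r by (intro nn_integral_Gamma_scaled) auto
    finally have "ennreal C * (\<integral>\<^sup>+s. ennreal (s powr (\<alpha> - 1)) * eneg (ennreal s * x) * indicator {0<..} s \<partial>lborel) =
        ennreal (aB * (t * r) powr (- \<alpha>))"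
      using C G assms r by (simp add: C_def ennreal_mult'[symmetric] powr_mult)
    also have "\<dots> = emeasure intensityB {ennreal (t * r)<..}"
      using assms r by (intro power_lawD(3)[OF intensityB_power_law, symmetric]) simp
    finally show ?thesis
      using real assms r by (simp add: ennreal_mult'[symmetric])
  next
    \<comment> \<open>Both sides are 0: no power exceeds an infinite interference, and the
      exponential vanishes for every positive \<open>s\<close>.\<close>
    case top
    have "(\<integral>\<^sup>+s. ennreal (s powr (\<alpha> - 1)) * eneg (ennreal s * x) * indicator {0<..} s \<partial>lborel) = (\<integral>\<^sup>+(s :: real). 0 \<partial>lborel)"
      using top by (intro nn_integral_cong) (auto simp: indicator_def ennreal_mult_top)
    moreover have "{ennreal t * x<..} = {}"
      using top assms by (auto simp: ennreal_mult_top)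
    ultimately show ?thesis by simp
  qed
  have "(\<integral>\<^sup>+\<omega>. emeasure intensityB {ennreal t * total_power \<omega><..} \<partial>M) =
      (\<integral>\<^sup>+\<omega>. ennreal C * (\<integral>\<^sup>+s. ennreal (s powr (\<alpha> - 1)) * eneg (ennreal s * total_power \<omega>) * indicator {0<..} s \<partial>lborel) \<partial>M)"
    using total_power_nonzero by (intro nn_integral_cong_AE, eventually_elim) (rule tail)
  also have "\<dots> = ennreal C * (\<integral>\<^sup>+\<omega>. \<integral>\<^sup>+s. ennreal (s powr (\<alpha> - 1)) * eneg (ennreal s * total_power \<omega>) * indicator {0<..} s \<partial>lborel \<partial>M)"
    by (rule nn_integral_cmult) measurable
  also have "(\<integral>\<^sup>+\<omega>. \<integral>\<^sup>+s. ennreal (s powr (\<alpha> - 1)) * eneg (ennreal s * total_power \<omega>) * indicator {0<..} s \<partial>lborel \<partial>M) =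
      (\<integral>\<^sup>+s. \<integral>\<^sup>+\<omega>. ennreal (s powr (\<alpha> - 1)) * eneg (ennreal s * total_power \<omega>) * indicator {0<..} s \<partial>M \<partial>lborel)"
  proof -
    interpret pair_sigma_finite lborel M ..
    show ?thesis by (rule Fubini') measurable
  qed
  also have "\<dots> = (\<integral>\<^sup>+s. ennreal (s powr (\<alpha> - 1) * exp (- (c * s powr \<alpha>))) * indicator {0<..} s \<partial>lborel)"
  proof (rule nn_integral_cong)
    fix s :: real
    show "(\<integral>\<^sup>+\<omega>. ennreal (s powr (\<alpha> - 1)) * eneg (ennreal s * total_power \<omega>) * indicator {0<..} s \<partial>M) =
        ennreal (s powr (\<alpha> - 1) * exp (- (c * s powr \<alpha>))) * indicator {0<..} s"
    proof (cases "0 < s")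
      case True
      then show ?thesis
        by (simp add: nn_integral_cmult total_power_stable c_def ennreal_mult'[symmetric])
    qed simp
  qed
  also have "\<dots> = ennreal (1 / (c * \<alpha>))"
    using c alpha by (intro nn_integral_stretched_exp)
  also have "ennreal C * \<dots> = ennreal (C * (1 / (c * \<alpha>)))"
    using C by (rule ennreal_mult'[symmetric])
  \<comment> \<open>The \<alpha> from the stretched exponential and the
    \<open>Gamma \<alpha>\<close> in \<open>C\<close> merge into
    \<open>Gamma (1 + \<alpha>)\<close>.\<close>
  also have "C * (1 / (c * \<alpha>)) = t powr (- \<alpha>) / (Gamma (1 + \<alpha>) * Gamma (1 - \<alpha>)) * (aB / (aB + aD))"
  proof -
    have "Gamma (1 + \<alpha>) = \<alpha> * Gamma \<alpha>"
      using Gamma_plus1[of \<alpha>] nonpos_Ints_nonpos[of \<alpha>] alpha(1) by (metis add.commute not_le)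
    then show ?thesis
      using G propagation_consts_pos by (simp add: C_def c_def ac_simps)
  qed
  finally show ?thesis .
qed

text \<open>Every other power is part of the interference that a base station faces. With
  \<open>t \<ge> 1\<close>, one that exceeds the threshold is therefore strictly stronger than all
  others, so two cannot exceed at once and the sum is the indicator of the connection event.\<close>

lemma emeasure_connection:
  assumes "1 \<le> t"
  shows "emeasure M {\<omega> \<in> space M. (SUP i. sir kappa beta X Y Fm Em i \<omega>) > ennreal t} =
    (\<integral>\<^sup>+\<omega>. (\<Sum>i. indicator {x. ennreal t * others i \<omega> < x} (powerB i \<omega>)) \<partial>M)"
proof -
  let ?S = "{\<omega> \<in> space M. (SUP i. sir kappa beta X Y Fm Em i \<omega>) > ennreal t}"
  have sir: "ennreal t < sir kappa beta X Y Fm Em i \<omega> \<longleftrightarrow> ennreal t * others i \<omega> < powerB i \<omega>" for i \<omega>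
    unfolding sir_def using assms by (intro ennreal_less_divide_iff) simp
  have le: "powerB k \<omega> < powerB i \<omega>" if "ennreal t * others i \<omega> < powerB i \<omega>" "k \<noteq> i" for i k \<omega>
  proof -
    have "powerB i \<omega> + powerB k \<omega> = (\<Sum>j\<in>{i, k}. powerB j \<omega>)"
      using \<open>k \<noteq> i\<close> by simp
    also have "\<dots> \<le> interference kappa beta X Fm \<omega>"
      unfolding interference_def by (rule sum_le_suminf) auto
    finally have "powerB k \<omega> \<le> interference kappa beta X Fm \<omega> - powerB i \<omega>"
      by (rule ennreal_le_diff)
    also have "\<dots> \<le> others i \<omega>" by simp
    also have "\<dots> \<le> ennreal t * others i \<omega>"
      using mult_right_mono[of 1 "ennreal t" "others i \<omega>"] assms by simp
    finally show ?thesis using that(1) by simp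
  qed
  have [measurable]: "sir kappa beta X Y Fm Em i \<in> borel_measurable M" for i
    unfolding sir_def[abs_def] by measurable
  have "(\<Sum>i. indicator {x. ennreal t * others i \<omega> < x} (powerB i \<omega>)) = (indicator ?S \<omega> :: ennreal)"
    if "\<omega> \<in> space M" for \<omega>
  proof (cases "\<exists>i. ennreal t * others i \<omega> < powerB i \<omega>")
    case True
    then obtain i where i: "ennreal t * others i \<omega> < powerB i \<omega>" by blast
    have "(\<Sum>k. indicator {x. ennreal t * others k \<omega> < x} (powerB k \<omega>)) =
        (\<Sum>k\<in>{i}. indicator {x. ennreal t * others k \<omega> < x} (powerB k \<omega>) :: ennreal)"
    proof (rule suminf_finite)
      fix k assume "k \<notin> {i}"
      then have "\<not> ennreal t * others k \<omega> < powerB k \<omega>"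
        using le[OF i, of k] le[of \<omega> k i] by auto
      then show "indicator {x. ennreal t * others k \<omega> < x} (powerB k \<omega>) = (0 :: ennreal)" by simp
    qed simp
    moreover have "\<omega> \<in> ?S"
      using that i by (auto simp: less_SUP_iff sir)
    ultimately show ?thesis using i by simp
  next
    case False
    then have "\<omega> \<notin> ?S" by (auto simp: less_SUP_iff sir)
    with False show ?thesis by simp
  qed
  then have "(\<integral>\<^sup>+\<omega>. (\<Sum>i. indicator {x. ennreal t * others i \<omega> < x} (powerB i \<omega>)) \<partial>M) = (\<integral>\<^sup>+\<omega>. indicator ?S \<omega> \<partial>M)"
    by (rule nn_integral_cong)
  also have "\<dots> = emeasure M ?S"
    by (rule nn_integral_indicator) measurable
  finally show ?thesis ..
qed

end

theorem proposition3:
  fixes M :: "'a measure"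
    and beta kappa lamB lamD tau :: real
    and X Y :: "nat \<Rightarrow> 'a \<Rightarrow> real ^ 2"
    and F :: "'a \<Rightarrow> real"
    and Fm Em :: "nat \<Rightarrow> 'a \<Rightarrow> real"
  assumes "beta > 2" and "kappa > 0" and "lamB > 0" and "lamD > 0"
    and "network_model M beta lamB lamD X Y F Fm Em"
    and "tau \<ge> 1"
  shows "connection_probability_BS M kappa beta X Y Fm Em tau =
    tau powr (- 2 / beta) / (Gamma (1 + 2 / beta) * Gamma (1 - 2 / beta)) *
    (propagation_const_BS M kappa beta lamB F /
      (propagation_const_BS M kappa beta lamB F + propagation_const_Dev kappa beta lamD))"
proof -
  interpret network_model M beta lamB lamD X Y F Fm Em by fact
  interpret positive_network M beta lamB lamD X Y F Fm Em kappa
    by unfold_locales fact+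
  have "emeasure M {\<omega> \<in> space M. (SUP i. sir kappa beta X Y Fm Em i \<omega>) > ennreal tau} =
      ennreal (tau powr (- (2 / beta)) / (Gamma (1 + 2 / beta) * Gamma (1 - 2 / beta)) * (aB / (aB + aD)))"
    using \<open>tau \<ge> 1\<close> by (simp only: emeasure_connection) (simp add: expected_exceedances exceedance_integral)
  \<comment> \<open>Nonnegativity lets the value pass unchanged from \<open>ennreal\<close> to the
    real-valued \<open>measure\<close>.\<close>
  moreover have "0 \<le> tau powr (- (2 / beta)) / (Gamma (1 + 2 / beta) * Gamma (1 - 2 / beta)) * (aB / (aB + aD))"
    using propagation_consts_pos alpha
    by (intro mult_nonneg_nonneg divide_nonneg_nonneg less_imp_le[OF Gamma_real_pos]) (auto intro: add_pos_pos)
  ultimately show ?thesis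
    by (simp add: connection_probability_BS_def measure_def)
qed

end
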